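(* For every real $r>1$, both the Hilbert-space and the Banach-space worst case power functions at $(r,\infty)$ satisfy $$\ell^{\,\mathrm{wor}\text{-}H}(r,\infty)\in\left[\frac{r-1}{r},\,1\right]\qquad\text{and}\qquad \ell^{\,\mathrm{wor}\text{-}B}(r,\infty)\in\left[\frac{r-1}{r},\,1\right].$$
   Context: Rate of convergence. For a sequence $(c_n)$ of nonnegative numbers converging to zero, $r(c_n):=\sup\{\beta\ge 0 : \lim_{n\to\infty}c_n n^{\beta}=0\}$; if $(c_n)$ does not converge to zero, $r(c_n):=0$. Setting. Let $p\in[1,\infty]$. $F$ is a (real) Hilbert or Banach space of functions defined on a set $\Omega$ such that for every $x\in\Omega$ the functional $f\mapsto f(x)$ is linear and continuous on $F$; $F\subset L_p=L_p(\Omega,\mu)$ and the embedding $I:F\to L_p$, $I(f)=f$, is continuous. The set $\Omega$ and the underlying measure $\mu$ of $L_p$ are arbitrary. $\|\cdot\|_p$ is the norm of $L_p$. Information and algorithms. $\Lambda^{\rm all}=F^*$ is the class of all continuous linear functionals on $F$, and $\Lambda^{\rm std}\subseteq\Lambda^{\rm all}$ is the class of function evaluations $L_x(f)=f(x)$, $x\in\Omega$. For a class $\Lambda\in\{\Lambda^{\rm all},\Lambda^{\rm std}\}$ an algorithm using $n$ functionals from $\Lambda$ is a map $A_n:F\to L_p$ of the form $A_n(f)=\phi_n(L_1(f),\dots,L_n(f))$, where $\phi_n:\mathbb{R}^n\to L_p$ is an arbitrary mapping and $L_j\in\Lambda$; the choice of $L_j$ may be adaptive, i.e. $L_j$ may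 depend on the already computed values $L_1(f),\dots,L_{j-1}(f)$. For $n=0$, $A_0(f)$ is a fixed element of $L_p$. Minimal worst case errors. For $n=0,1,2,\dots$, $$e_n^{\rm all\text{-}wor}(F,L_p)=\inf_{A_n\text{ with }L_j\in\Lambda^{\rm all}}\ \sup_{\|f\|_F\le1}\|f-A_n(f)\|_p,\qquad e_n^{\rm std\text{-}wor}(F,L_p)=\inf_{A_n\text{ with }L_j\in\Lambda^{\rm std}}\ \sup_{\|f\|_F\le1}\|f-A_n(f)\|_p.$$ Put $r^{\rm all\text{-}wor}(F,L_p)=r\big(e_n^{\rm all\text{-}wor}(F,L_p)\big)$ and $r^{\rm std\text{-}wor}(F,L_p)=r\big(e_n^{\rm std\text{-}wor}(F,L_p)\big)$. Power function. For $r\in(0,\infty)$, $p\in[1,\infty]$ and $\mathrm{x}\in\{H,B\}$, $$\ell^{\,\mathrm{wor}\text{-}\mathrm{x}}(r,p):=\inf_{F:\ r^{\rm all\text{-}wor}(F,L_p)=r}\ \frac{r^{\rm std\text{-}wor}(F,L_p)}{r},$$ where the infimum is over all Hilbert spaces $F$ (if $\mathrm{x}=H$) or over all Banach spaces $F$ (if $\mathrm{x}=B$) as in the setting above (continuously embedded in $L_p$, with continuous function evaluations) satisfying $r^{\rm all\text{-}wor}(F,L_p)=r$.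
   Formalization: In the Banach case F must also have one null set off which |f(x)| ≤ ‖f‖_∞ for all f in F; with the essential-sup norm the claim fails for some nonseparable Banach F. F ⊂ L_∞ is read as injective up to null sets. *)

theory Defs
  imports "HOL-Probability.Essential_Supremum"
begin

section \<open>Rate of convergence\<close>

text \<open>Errors and rates live in \<^typ>\<open>ennreal\<close>, so that suprema and infima need no boundedness side
  conditions. In particular a rate may be infinite, and an infimum over an empty class is
  infinite.\<close>

definition rate :: "(nat \<Rightarrow> ennreal) \<Rightarrow> ennreal" where
  "rate c =
     (if c \<longlonglongrightarrow> 0
      then (SUP \<beta> \<in> {\<beta>::real. 0 \<le> \<beta> \<and> (\<lambda>n. c n * ennreal (real n powr \<beta>)) \<longlonglongrightarrow> 0}. ennreal \<beta>)
      else 0)"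


section \<open>The target space\<close>

text \<open>Elements of \<open>L\<^sub>p\<close> are handled through measurable representatives. The norm does not depend on
  the representative.\<close>

definition Lp_norm :: "'a measure \<Rightarrow> ennreal \<Rightarrow> ('a \<Rightarrow> real) \<Rightarrow> ennreal" where
  "Lp_norm M p g =
     (if p = \<infinity> then esssup M (\<lambda>x. ennreal \<bar>g x\<bar>)
      else (let I = \<integral>\<^sup>+ x. ennreal (\<bar>g x\<bar> powr enn2real p) \<partial>M
            in if I = \<infinity> then \<infinity> else ennreal (enn2real I powr (1 / enn2real p))))"

definition Lp :: "'a measure \<Rightarrow> ennreal \<Rightarrow> ('a \<Rightarrow> real) set" where
  "Lp M p = {g \<in> borel_measurable M. Lp_norm M p g < \<infinity>}"


section \<open>Information functionals\<close>

text \<open>A normed function space is a carrier \<open>F\<close> of functions together with a norm \<open>N\<close>. Functionals are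
  total maps on \<^typ>\<open>'a \<Rightarrow> real\<close>, of which only the values on \<open>F\<close> matter.\<close>

definition all_info :: "('a \<Rightarrow> real) set \<Rightarrow> (('a \<Rightarrow> real) \<Rightarrow> real) \<Rightarrow> (('a \<Rightarrow> real) \<Rightarrow> real) set" where
  "all_info F N =
     {L. (\<forall>f\<in>F. \<forall>g\<in>F. L (\<lambda>x. f x + g x) = L f + L g) \<and>
         (\<forall>c. \<forall>f\<in>F. L (\<lambda>x. c * f x) = c * L f) \<and>
         (\<exists>C. \<forall>f\<in>F. \<bar>L f\<bar> \<le> C * N f)}"

definition std_info :: "'a set \<Rightarrow> (('a \<Rightarrow> real) \<Rightarrow> real) set" where
  "std_info \<Omega> = (\<lambda>x f. f x) ` \<Omega>"


section \<open>Banach and Hilbert spaces of functions\<close>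

text \<open>A function on \<open>\<Omega>\<close> is represented by its extension by zero to the whole type. Completeness is
  spelled out because \<^const>\<open>Metric_space.mcomplete\<close> would force conditions on \<open>N\<close> outside \<open>F\<close>.\<close>

locale banach_function_space =
  fixes \<Omega> :: "'a set" and F :: "('a \<Rightarrow> real) set" and N :: "('a \<Rightarrow> real) \<Rightarrow> real"
  assumes supported: "\<And>f x. f \<in> F \<Longrightarrow> x \<notin> \<Omega> \<Longrightarrow> f x = 0"
    and zero_mem: "(\<lambda>x. 0) \<in> F"
    and add_mem: "\<And>f g. f \<in> F \<Longrightarrow> g \<in> F \<Longrightarrow> (\<lambda>x. f x + g x) \<in> F"
    and scale_mem: "\<And>c f. f \<in> F \<Longrightarrow> (\<lambda>x. c * f x) \<in> F"
    and norm_nonneg: "\<And>f. f \<in> F \<Longrightarrow> 0 \<le> N f"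
    and norm_eq_0_iff: "\<And>f. f \<in> F \<Longrightarrow> N f = 0 \<longleftrightarrow> f = (\<lambda>x. 0)"
    and norm_triangle: "\<And>f g. f \<in> F \<Longrightarrow> g \<in> F \<Longrightarrow> N (\<lambda>x. f x + g x) \<le> N f + N g"
    and norm_scale: "\<And>c f. f \<in> F \<Longrightarrow> N (\<lambda>x. c * f x) = \<bar>c\<bar> * N f"
    and complete: "\<And>s. (\<And>n. s n \<in> F) \<Longrightarrow>
        (\<And>e. 0 < e \<Longrightarrow> \<exists>K::nat. \<forall>m\<ge>K. \<forall>n\<ge>K. N (\<lambda>x. s m x - s n x) < e) \<Longrightarrow>
        \<exists>f\<in>F. (\<lambda>n. N (\<lambda>x. s n x - f x)) \<longlonglongrightarrow> 0"
    and eval_continuous: "std_info \<Omega> \<subseteq> all_info F N"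

locale hilbert_function_space = banach_function_space +
  assumes ex_inner: "\<exists>ip :: ('a \<Rightarrow> real) \<Rightarrow> ('a \<Rightarrow> real) \<Rightarrow> real.
      (\<forall>f\<in>F. \<forall>g\<in>F. ip f g = ip g f) \<and>
      (\<forall>f\<in>F. \<forall>g\<in>F. \<forall>h\<in>F. ip (\<lambda>x. f x + g x) h = ip f h + ip g h) \<and>
      (\<forall>c. \<forall>f\<in>F. \<forall>g\<in>F. ip (\<lambda>x. c * f x) g = c * ip f g) \<and>
      (\<forall>f\<in>F. (N f)\<^sup>2 = ip f f)"

text \<open>The last conjunct expresses that \<open>F\<close> is a subset of \<open>L\<^sub>p\<close> even after functions that agree almost
  everywhere are identified.\<close>

definition embedded_in_Lp ::
    "'a measure \<Rightarrow> ennreal \<Rightarrow> ('a \<Rightarrow> real) set \<Rightarrow> (('a \<Rightarrow> real) \<Rightarrow> real) \<Rightarrow> bool" where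
  "embedded_in_Lp M p F N \<longleftrightarrow>
     F \<subseteq> Lp M p \<and>
     (\<exists>C. \<forall>f\<in>F. Lp_norm M p f \<le> ennreal (C * N f)) \<and>
     (\<forall>f\<in>F. \<forall>g\<in>F. (AE x in M. f x = g x) \<longrightarrow> f = g)"


section \<open>Algorithms and minimal worst case errors\<close>

text \<open>The next functional is chosen by \<open>S\<close> from the list of the values computed so far.\<close>

primrec info :: "(real list \<Rightarrow> ('a \<Rightarrow> real) \<Rightarrow> real) \<Rightarrow> ('a \<Rightarrow> real) \<Rightarrow> nat \<Rightarrow> real list" where
  "info S f 0 = []"
| "info S f (Suc n) = info S f n @ [S (info S f n) f]"

definition algorithms ::
    "'a measure \<Rightarrow> ennreal \<Rightarrow> (('a \<Rightarrow> real) \<Rightarrow> real) set \<Rightarrow> nat \<Rightarrow> (('a \<Rightarrow> real) \<Rightarrow> 'a \<Rightarrow> real) set" where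
  "algorithms M p \<Lambda> n =
     {\<lambda>f. \<phi> (info S f n) | S \<phi>.
        (\<forall>ys. length ys < n \<longrightarrow> S ys \<in> \<Lambda>) \<and> (\<forall>ys. length ys = n \<longrightarrow> \<phi> ys \<in> Lp M p)}"

definition wor_error ::
    "'a measure \<Rightarrow> ennreal \<Rightarrow> ('a \<Rightarrow> real) set \<Rightarrow> (('a \<Rightarrow> real) \<Rightarrow> real) \<Rightarrow>
     (('a \<Rightarrow> real) \<Rightarrow> 'a \<Rightarrow> real) \<Rightarrow> ennreal" where
  "wor_error M p F N A = (SUP f \<in> {f \<in> F. N f \<le> 1}. Lp_norm M p (\<lambda>x. f x - A f x))"

definition min_error ::
    "'a measure \<Rightarrow> ennreal \<Rightarrow> ('a \<Rightarrow> real) set \<Rightarrow> (('a \<Rightarrow> real) \<Rightarrow> real) \<Rightarrow>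
     (('a \<Rightarrow> real) \<Rightarrow> real) set \<Rightarrow> nat \<Rightarrow> ennreal" where
  "min_error M p F N \<Lambda> n = (INF A \<in> algorithms M p \<Lambda> n. wor_error M p F N A)"

definition rate_all ::
    "'a measure \<Rightarrow> ennreal \<Rightarrow> ('a \<Rightarrow> real) set \<Rightarrow> (('a \<Rightarrow> real) \<Rightarrow> real) \<Rightarrow> ennreal" where
  "rate_all M p F N = rate (min_error M p F N (all_info F N))"

definition rate_std ::
    "'a measure \<Rightarrow> ennreal \<Rightarrow> ('a \<Rightarrow> real) set \<Rightarrow> (('a \<Rightarrow> real) \<Rightarrow> real) \<Rightarrow> ennreal" where
  "rate_std M p F N = rate (min_error M p F N (std_info (space M)))"


section \<open>Power functions\<close>

text \<open>For \<open>p = \<infinity>\<close> the values of \<open>f\<close> are related to the essential supremum of \<open>f\<close> only off a null set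
  that may depend on \<open>f\<close>. The following property says that one null set serves all of \<open>F\<close>. It holds
  if \<open>F\<close> is separable, and for sup-norm approximation, where \<open>M\<close> is the counting measure.

  For nonseparable Banach spaces it can fail, and function values may then be useless. Take Lebesgue
  measure on \<open>[0,1]\<close>, a partition into intervals \<open>I\<^sub>k\<close> of positive length, and almost disjoint infinite
  sets \<open>A\<^sub>t\<close> of positive integers for \<open>t \<in> [0,1]\<close>. Let \<open>E\<close> be the closed span of \<open>c\<^sub>0\<close> and the
  indicators of the \<open>A\<^sub>t\<close> in \<open>\<ell>\<^sub>\<infinity>\<close>, and give the function that maps \<open>x \<in> I\<^sub>k\<close> to \<open>a\<^sub>k / k powr r\<close> plus
  the limit of \<open>a\<close> along \<open>A\<^sub>x\<close> the norm of \<open>a \<in> E\<close>. The limits vanish off a countable set depending on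
  \<open>a\<close>, so the rate for all linear functionals is \<open>r\<close>. But changing \<open>a\<close> far out along \<open>A\<^sub>t\<close> alters the
  value at \<open>t\<close> arbitrarily, and the rate for function values is \<open>0\<close>.\<close>

definition common_null_set :: "'a measure \<Rightarrow> ('a \<Rightarrow> real) set \<Rightarrow> bool" where
  "common_null_set M F \<longleftrightarrow>
     (\<exists>Z\<in>null_sets M. \<forall>f\<in>F. \<forall>x\<in>space M - Z. ennreal \<bar>f x\<bar> \<le> Lp_norm M \<infinity> f)"

text \<open>The domain and the measure are arbitrary, hence the infimum ranges over them as well. The type
  argument only bounds the domain, which is \<^term>\<open>space M\<close>.\<close>

definition power_fun_H :: "'a itself \<Rightarrow> real \<Rightarrow> ennreal \<Rightarrow> ennreal" where
  "power_fun_H _ r p =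
     Inf {rate_std M p F N / ennreal r | (M :: 'a measure) F N.
            hilbert_function_space (space M) F N \<and> embedded_in_Lp M p F N \<and>
            rate_all M p F N = ennreal r}"

definition power_fun_B :: "'a itself \<Rightarrow> real \<Rightarrow> ennreal \<Rightarrow> ennreal" where
  "power_fun_B _ r p =
     Inf {rate_std M p F N / ennreal r | (M :: 'a measure) F N.
            banach_function_space (space M) F N \<and> embedded_in_Lp M p F N \<and>
            (p = \<infinity> \<longrightarrow> common_null_set M F) \<and>
            rate_all M p F N = ennreal r}"

end

theory Submission
  imports Defs "Jordan_Normal_Form.Determinant"
begin

text \<open>The upper bound 1 holds because function values are continuous functionals, so that
\<^term>\<open>rate_std M p F N\<close> never exceeds \<^term>\<open>rate_all M p F N\<close>, and because some Hilbert space has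
the rate \<open>r\<close>: on a sequence of points, take the square summable sequences divided by the weights
\<open>(i + 1) powr r\<close>. The first \<open>n\<close> coordinates give the error \<open>(n + 1) powr (- r)\<close>. No \<open>n\<close> functionals
do better by more than a constant, because an \<open>n\<close>-dimensional subspace of \<open>\<real>\<^sup>2\<^sup>n\<close> contains a
Euclidean unit vector with a coordinate of size at least \<open>1 / sqrt 2\<close>
(\<open>kernel_has_large_coordinate\<close>).

The lower bound is the inequality \<open>e\<^sub>n(std) \<le> (4 n + 2) e\<^sub>n(all)\<close>, valid for every Banach space whose
functions are dominated by their \<open>L\<^sub>\<infinity>\<close> norms off one common null set \<open>Z\<close>
(\<open>std_error_le_all_error\<close>); the factor of order \<open>n\<close> costs exactly 1 in the rate. An algorithm with
error \<open>E\<close> yields \<open>n\<close> functionals on whose common kernel the \<open>L\<^sub>\<infinity>\<close> norm is at most \<open>E\<close> times the norm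
of \<open>F\<close>. By a Hahn-Banach argument that adds one functional at a time, every point evaluation off \<open>Z\<close>
is then within \<open>E\<close> of the span of these functionals. So the evaluations are, up to \<open>E\<close>, vectors in an
\<open>n\<close>-dimensional space, and at most \<open>n\<close> of them with nearly maximal determinant represent all others with
coefficients bounded by 2 (\<open>barycentric_points\<close>). A function of norm at most 1 that vanishes at these
points is therefore bounded by \<open>(2 n + 1) E\<close> off \<open>Z\<close>, and the algorithm that returns any function of the
unit ball with the observed values errs by at most twice that.

For Hilbert spaces the common null set is a consequence of the rate being positive
(\<open>hilbert_common_null_set\<close>). Errors tending to 0 give countably many functionals whose common kernel is
trivial. Countably many functions then suffice to approximate each \<open>f\<close> simultaneously in these
functionals and in the \<open>L\<^sub>\<infinity>\<close> norm, with bounded norms in \<open>F\<close>. Bounded sets of a Hilbert space are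
weakly compact, so the approximation also holds at every point of the domain, and the union of the
exceptional sets of the countably many functions serves all of \<open>F\<close>. Consequently the infimum over
Hilbert spaces is at least the one over Banach spaces, and only the extreme inequalities remain.\<close>

section \<open>Near-maximal determinants\<close>

unbundle no vec_syntax

lemma nontrivial_solution:
  fixes c :: "nat \<Rightarrow> nat \<Rightarrow> real"
  assumes "n < k"
  obtains v where "\<exists>j<k. v j \<noteq> 0" and "\<And>i. i < n \<Longrightarrow> (\<Sum>j<k. c i j * v j) = 0"
proof -
  define A where "A = Matrix.mat k k (\<lambda>(i, j). if i < n then c i j else 0)"
  have A: "A \<in> carrier_mat k k" by (simp add: A_def)
  have "Determinant.det A = (\<Sum>j<k. A $$ (n, j) * cofactor A n j)"
    using assms by (intro laplace_expansion_row[OF A]) auto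
  also have "\<dots> = 0"
    using assms by (intro sum.neutral) (simp add: A_def)
  finally obtain v where v: "v \<in> carrier_vec k" "v \<noteq> 0\<^sub>v k" "A *\<^sub>v v = 0\<^sub>v k"
    using det_0_iff_vec_prod_zero[OF A] by auto
  have nz: "\<exists>j<k. v $ j \<noteq> 0"
    using v(1,2) by (metis carrier_vecD eq_vecI index_zero_vec(1,2))
  have "(\<Sum>j<k. c i j * v $ j) = 0" if "i < n" for i
  proof -
    have "0 = (A *\<^sub>v v) $ i" using v(3) that assms by simp
    also have "\<dots> = (\<Sum>j<k. c i j * v $ j)"
      using that assms v(1) A
      by (auto simp: scalar_prod_def A_def atLeast0LessThan intro!: sum.cong)
    finally show ?thesis by simp
  qed
  with nz show ?thesis by (intro that[of "\<lambda>j. v $ j"]) auto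
qed

text \<open>A factorization of the pairing through \<open>\<real>\<^sup>n\<close> leaves a nontrivial combination of more than \<open>n\<close>
columns that all \<open>n\<close> forms \<open>b l\<close> annihilate.\<close>

lemma det_eq_0_if_low_rank:
  fixes w :: "'p \<Rightarrow> 'q \<Rightarrow> real"
  assumes "n < k"
    and w: "\<And>i j. i < k \<Longrightarrow> j < k \<Longrightarrow> w (x i) (g j) = (\<Sum>l<n. a (x i) l * b l (g j))"
  shows "Determinant.det (Matrix.mat k k (\<lambda>(i, j). w (x i) (g j))) = 0"
proof -
  define A where "A = Matrix.mat k k (\<lambda>(i, j). w (x i) (g j))"
  have A: "A \<in> carrier_mat k k" by (simp add: A_def)
  obtain v where nz: "\<exists>j<k. v j \<noteq> 0" and v: "\<And>l. l < n \<Longrightarrow> (\<Sum>j<k. b l (g j) * v j) = 0"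
    using nontrivial_solution[OF \<open>n < k\<close>, of "\<lambda>l j. b l (g j)"] by blast
  have "A *\<^sub>v Matrix.vec k v = 0\<^sub>v k"
  proof (rule eq_vecI)
    fix i assume "i < dim_vec (0\<^sub>v k :: real Matrix.vec)"
    then have i: "i < k" by simp
    have "(A *\<^sub>v Matrix.vec k v) $ i = (\<Sum>j<k. w (x i) (g j) * v j)"
      using i A by (auto simp: scalar_prod_def A_def atLeast0LessThan intro!: sum.cong)
    also have "\<dots> = (\<Sum>j<k. \<Sum>l<n. a (x i) l * (b l (g j) * v j))"
      using i by (intro sum.cong) (auto simp: w sum_distrib_right mult.assoc)
    also have "\<dots> = (\<Sum>l<n. a (x i) l * (\<Sum>j<k. b l (g j) * v j))"
      by (subst sum.swap) (simp add: sum_distrib_left)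
    also have "\<dots> = 0" using v by simp
    finally show "(A *\<^sub>v Matrix.vec k v) $ i = 0\<^sub>v k $ i" using i by simp
  qed (use A in simp)
  moreover have "Matrix.vec k v \<noteq> 0\<^sub>v k"
    using nz by (metis index_vec index_zero_vec(1))
  ultimately show ?thesis
    unfolding A_def[symmetric] using det_0_iff_vec_prod_zero[OF A] vec_carrier by blast
qed

lemma abs_det_le:
  fixes A :: "real mat"
  assumes A: "A \<in> carrier_mat k k" and le: "\<And>i j. i < k \<Longrightarrow> j < k \<Longrightarrow> \<bar>A $$ (i, j)\<bar> \<le> B"
  shows "\<bar>Determinant.det A\<bar> \<le> (\<Sum>p\<in>{p. p permutes {0..<k}}. B ^ k)"
proof -
  have "\<bar>Determinant.det A\<bar> \<le> (\<Sum>p\<in>{p. p permutes {0..<k}}. \<bar>signof p * (\<Prod>i=0..<k. A $$ (i, p i))\<bar>)"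
    unfolding det_def'[OF A] by (rule sum_abs)
  also have "\<dots> \<le> (\<Sum>p\<in>{p. p permutes {0..<k}}. B ^ k)"
  proof (rule sum_mono)
    fix p assume "p \<in> {p. p permutes {0..<k}}"
    then have p: "p i < k" if "i < k" for i
      using that permutes_in_image[of p "{0..<k}" i] by auto
    have "\<bar>signof p * (\<Prod>i=0..<k. A $$ (i, p i))\<bar> = (\<Prod>i=0..<k. \<bar>A $$ (i, p i)\<bar>)"
      by (simp add: abs_mult abs_prod sign_def)
    also have "\<dots> \<le> (\<Prod>i=0..<k. B)"
      using le p by (intro prod_mono) auto
    finally show "\<bar>signof p * (\<Prod>i=0..<k. A $$ (i, p i))\<bar> \<le> B ^ k" by simp
  qed
  finally show ?thesis .
qed

text \<open>Among all nonsingular matrices \<open>w (x i) (g j)\<close> take one of maximal size \<open>k\<close>, fix its columns \<open>g\<close>,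
and move its rows to points \<open>x\<close> where the determinant is at least half of its supremum. Bordering the
matrix with a further row \<open>y\<close> and a further column \<open>f\<close> gives determinant 0 by maximality of \<open>k\<close>.
Laplace expansion along the new column expresses \<open>w y f\<close> by the values \<open>w (x i) f\<close>, and
the coefficients, being ratios of two determinants of row systems of size \<open>k\<close>, are at most 2 in modulus. The
exact maximum, which would give the bound 1, need not be attained.\<close>

lemma barycentric_points:
  fixes w :: "'p \<Rightarrow> 'q \<Rightarrow> real"
  assumes bounded: "\<And>g. g \<in> G \<Longrightarrow> \<exists>C. \<forall>x\<in>X. \<bar>w x g\<bar> \<le> C"
    and rank: "\<And>x g. x \<in> X \<Longrightarrow> g \<in> G \<Longrightarrow> w x g = (\<Sum>l<n. a x l * b l g)"
  obtains k x where "k \<le> n" and "\<And>i::nat. i < k \<Longrightarrow> x i \<in> X"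
    and "\<And>y. y \<in> X \<Longrightarrow> \<exists>\<alpha>. (\<forall>i<k. \<bar>\<alpha> i\<bar> \<le> 2) \<and> (\<forall>g\<in>G. w y g = (\<Sum>i<k. \<alpha> i * w (x i) g))"
proof -
  define D where "D k x g = Determinant.det (Matrix.mat k k (\<lambda>(i, j). w (x i) (g j)))"
    for k and x :: "nat \<Rightarrow> 'p" and g :: "nat \<Rightarrow> 'q"
  define P where "P k \<longleftrightarrow> (\<exists>x g. (\<forall>i<k. x i \<in> X) \<and> (\<forall>i<k. g i \<in> G) \<and> D k x g \<noteq> 0)" for k
  have "P 0" by (simp add: P_def D_def)
  have P_le: "k \<le> n" if "P k" for k
  proof (rule ccontr)
    assume "\<not> k \<le> n"
    moreover obtain x g where "\<forall>i<k. x i \<in> X" "\<forall>i<k. g i \<in> G" "D k x g \<noteq> 0"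
      using \<open>P k\<close> by (auto simp: P_def)
    ultimately show False
      using det_eq_0_if_low_rank[of n k w x g a b] rank by (auto simp: D_def)
  qed
  define k where "k = (GREATEST k. P k)"
  have "P k" unfolding k_def using \<open>P 0\<close> P_le by (rule GreatestI_nat)
  have max: "\<not> P (Suc k)"
    unfolding k_def using Greatest_le_nat[of P "Suc (GREATEST k. P k)" n] P_le by auto
  obtain x0 g where x0: "\<forall>i<k. x0 i \<in> X" and g: "\<forall>i<k. g i \<in> G" and nz: "D k x0 g \<noteq> 0"
    using \<open>P k\<close> unfolding P_def by blast
  define V where "V = {\<bar>D k x g\<bar> | x. \<forall>i<k. x i \<in> X}"
  obtain C where C: "\<And>j y. j < k \<Longrightarrow> y \<in> X \<Longrightarrow> \<bar>w y (g j)\<bar> \<le> C j"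
  proof -
    have "\<forall>j. \<exists>C. j < k \<longrightarrow> (\<forall>y\<in>X. \<bar>w y (g j)\<bar> \<le> C)" using bounded g by blast
    from choice[OF this] show ?thesis using that by blast
  qed
  have "bdd_above V"
  proof (rule bdd_aboveI)
    fix t assume "t \<in> V"
    then obtain x where t: "t = \<bar>D k x g\<bar>" and x: "\<forall>i<k. x i \<in> X" by (auto simp: V_def)
    have "\<bar>w (x i) (g j)\<bar> \<le> (\<Sum>j<k. \<bar>C j\<bar>)" if "i < k" "j < k" for i j
    proof -
      have "\<bar>w (x i) (g j)\<bar> \<le> \<bar>C j\<bar>" using C[of j "x i"] x that by fastforce
      also have "\<dots> \<le> (\<Sum>j<k. \<bar>C j\<bar>)" using that by (intro member_le_sum) auto
      finally show ?thesis .
    qed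
    then show "t \<le> (\<Sum>p\<in>{p. p permutes {0..<k}}. (\<Sum>j<k. \<bar>C j\<bar>) ^ k)"
      unfolding t D_def by (intro abs_det_le) auto
  qed
  have "\<bar>D k x0 g\<bar> \<in> V" using x0 by (auto simp: V_def)
  then have pos: "0 < Sup V" using nz \<open>bdd_above V\<close>
    by (metis cSup_upper less_le_trans zero_less_abs_iff)
  then obtain t where "t \<in> V" "Sup V / 2 < t"
    using less_cSupE[of "Sup V / 2" V] \<open>\<bar>D k x0 g\<bar> \<in> V\<close> by (metis empty_iff half_gt_zero less_imp_neq linorder_not_less field_sum_of_halves less_add_same_cancel1)
  then obtain x where x: "\<forall>i<k. x i \<in> X" and big: "Sup V < 2 * \<bar>D k x g\<bar>"
    by (auto simp: V_def)
  have D_le: "\<bar>D k y g\<bar> \<le> 2 * \<bar>D k x g\<bar>" if "\<forall>i<k. y i \<in> X" for y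
  proof -
    have "\<bar>D k y g\<bar> \<in> V" using that by (auto simp: V_def)
    then show ?thesis using cSup_upper[OF _ \<open>bdd_above V\<close>] big by fastforce
  qed
  have Dx: "D k x g \<noteq> 0" using big pos by auto
  show ?thesis
  proof (rule that[of k x])
    show "k \<le> n" by (rule P_le[OF \<open>P k\<close>])
    show "x i \<in> X" if "i < k" for i using x that by simp
    fix y assume y: "y \<in> X"
    define x' where "x' = x(k := y)"
    \<comment> \<open>The rows that remain when row \<open>i\<close> of the bordered matrix is deleted: the points \<open>x\<close>
      with \<open>x i\<close> removed and \<open>y\<close> put at the end, and for \<open>i = k\<close> the points \<open>x\<close> themselves.\<close>
    define m where "m i = (\<lambda>j. x' (if j < i then j else Suc j))" for i
    define \<alpha> where "\<alpha> i = - ((-1) ^ (i + k) * D k (m i) g) / D k x g" for i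
    have m: "\<forall>j<k. m i j \<in> X" for i
      using x y by (auto simp: m_def x'_def less_Suc_eq)
    have "\<bar>\<alpha> i\<bar> \<le> 2" for i
      using D_le[OF m, of i] Dx by (simp add: \<alpha>_def abs_mult divide_le_eq power_abs)
    moreover have "w y f = (\<Sum>i<k. \<alpha> i * w (x i) f)" if f: "f \<in> G" for f
    proof -
      define g' where "g' = g(k := f)"
      define A where "A = Matrix.mat (Suc k) (Suc k) (\<lambda>(i, j). w (x' i) (g' j))"
      have A: "A \<in> carrier_mat (Suc k) (Suc k)" by (simp add: A_def)
      have del: "mat_delete A i k = Matrix.mat k k (\<lambda>(i', j). w (m i i') (g j))" for i
        unfolding mat_delete_def A_def
        by (rule eq_matI) (auto simp: m_def g'_def)
      have cof: "cofactor A i k = (-1) ^ (i + k) * D k (m i) g" for i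
        by (simp add: cofactor_def del D_def)
      have entry: "A $$ (i, k) = w (x' i) f" if "i < Suc k" for i
        using that by (simp add: A_def g'_def)
      have "\<forall>i<Suc k. x' i \<in> X" "\<forall>i<Suc k. g' i \<in> G"
        using x y g f by (auto simp: x'_def g'_def less_Suc_eq)
      then have "0 = D (Suc k) x' g'" using max unfolding P_def by metis
      also have "\<dots> = (\<Sum>i<Suc k. A $$ (i, k) * cofactor A i k)"
        unfolding D_def A_def[symmetric] by (rule laplace_expansion_column[OF A]) simp
      also have "\<dots> = (\<Sum>i<Suc k. w (x' i) f * ((-1) ^ (i + k) * D k (m i) g))"
        by (intro sum.cong) (simp_all add: cof entry)
      also have "\<dots> = (\<Sum>i<k. w (x i) f * ((-1) ^ (i + k) * D k (m i) g)) + w y f * D k (m k) g"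
        by (simp add: x'_def flip: mult_2 power_mult)
      also have "D k (m k) g = D k x g"
        unfolding D_def m_def x'_def by (intro arg_cong[where f = Determinant.det] eq_matI) auto
      finally have "w y f * D k x g = - (\<Sum>i<k. w (x i) f * ((-1) ^ (i + k) * D k (m i) g))"
        by linarith
      then have "w y f = - (\<Sum>i<k. w (x i) f * ((-1) ^ (i + k) * D k (m i) g)) / D k x g"
        using Dx by (simp add: field_simps)
      also have "\<dots> = (\<Sum>i<k. \<alpha> i * w (x i) f)"
        by (simp add: \<alpha>_def sum_negf sum_divide_distrib mult_ac flip: sum_negf)
      finally show ?thesis .
    qed
    ultimately show "\<exists>\<alpha>. (\<forall>i<k. \<bar>\<alpha> i\<bar> \<le> 2) \<and> (\<forall>g\<in>G. w y g = (\<Sum>i<k. \<alpha> i * w (x i) g))"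
      by blast
  qed
qed

section \<open>Approximating evaluations by finitely many functionals\<close>

definition linear_form :: "('a \<Rightarrow> real) set \<Rightarrow> (('a \<Rightarrow> real) \<Rightarrow> real) \<Rightarrow> bool" where
  "linear_form F L \<longleftrightarrow>
     (\<forall>f\<in>F. \<forall>g\<in>F. L (\<lambda>x. f x + g x) = L f + L g) \<and> (\<forall>c. \<forall>f\<in>F. L (\<lambda>x. c * f x) = c * L f)"

lemma linear_form_add: "linear_form F L \<Longrightarrow> f \<in> F \<Longrightarrow> g \<in> F \<Longrightarrow> L (\<lambda>x. f x + g x) = L f + L g"
  and linear_form_scale: "linear_form F L \<Longrightarrow> f \<in> F \<Longrightarrow> L (\<lambda>x. c * f x) = c * L f"
  by (simp_all add: linear_form_def)

lemma linear_form_subset: "linear_form F L \<Longrightarrow> W \<subseteq> F \<Longrightarrow> linear_form W L"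
  by (simp add: linear_form_def subset_iff)

lemma linear_form_diff_sum:
  assumes "linear_form F d" and "\<And>i. i < n \<Longrightarrow> linear_form F (L i)"
  shows "linear_form F (\<lambda>f. d f - (\<Sum>i<n. c i * L i f))"
  using assms
  by (auto simp: linear_form_def algebra_simps sum.distrib sum_distrib_left intro!: sum.cong)

text \<open>The part of the axioms that passes to the kernel of an arbitrary linear form, which need not be closed.\<close>

locale seminormed_function_space =
  fixes F :: "('a \<Rightarrow> real) set" and N :: "('a \<Rightarrow> real) \<Rightarrow> real"
  assumes zero_mem: "(\<lambda>x. 0) \<in> F"
    and add_mem: "\<And>f g. f \<in> F \<Longrightarrow> g \<in> F \<Longrightarrow> (\<lambda>x. f x + g x) \<in> F"
    and scale_mem: "\<And>c f. f \<in> F \<Longrightarrow> (\<lambda>x. c * f x) \<in> F"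
    and norm_nonneg: "\<And>f. f \<in> F \<Longrightarrow> 0 \<le> N f"
    and norm_triangle: "\<And>f g. f \<in> F \<Longrightarrow> g \<in> F \<Longrightarrow> N (\<lambda>x. f x + g x) \<le> N f + N g"
    and norm_scale: "\<And>c f. f \<in> F \<Longrightarrow> N (\<lambda>x. c * f x) = \<bar>c\<bar> * N f"
begin

lemma diff_mem: "f \<in> F \<Longrightarrow> g \<in> F \<Longrightarrow> (\<lambda>x. f x - g x) \<in> F"
  using add_mem[of f "\<lambda>x. - 1 * g x"] scale_mem[of g "- 1"] by simp

lemma norm_diff_le: "f \<in> F \<Longrightarrow> g \<in> F \<Longrightarrow> N (\<lambda>x. f x - g x) \<le> N f + N g"
  using norm_triangle[of f "\<lambda>x. - 1 * g x"] scale_mem[of g "- 1"] norm_scale[of g "- 1"] by simp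

lemma linear_form_diff:
  assumes "linear_form F L" "f \<in> F" "g \<in> F"
  shows "L (\<lambda>x. f x - g x) = L f - L g"
  using linear_form_add[of F L f "\<lambda>x. - 1 * g x"] linear_form_scale[of F L g "- 1"]
    scale_mem[of g "- 1"] assms by simp

lemma linear_form_zero: "linear_form F L \<Longrightarrow> L (\<lambda>x. 0) = 0"
  using linear_form_scale[of F L "\<lambda>x. 0" 0] zero_mem by simp

lemma kernel_subspace:
  assumes "linear_form F L"
  shows "seminormed_function_space {f \<in> F. L f = 0} N"
  using assms zero_mem
  by unfold_locales
    (auto simp: linear_form_add linear_form_scale linear_form_zero add_mem scale_mem
       norm_nonneg norm_triangle norm_scale)

text \<open>The extension step of the Hahn-Banach theorem, in the form of an approximation: subtracting a multiple
of \<open>L\<close> makes a form that is bounded on the kernel of \<open>L\<close> bounded everywhere, by the same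
constant. On the affine hyperplane \<open>L = 1\<close> the multiple \<open>c\<close> has to separate the values \<open>d f - e * N f\<close>
from the values \<open>d f + e * N f\<close>, and differences of elements of the hyperplane lie in the kernel.\<close>

lemma bounded_extension_one_step:
  assumes L: "linear_form F L" and d: "linear_form F d" and e: "0 \<le> e"
    and le: "\<And>f. f \<in> F \<Longrightarrow> L f = 0 \<Longrightarrow> \<bar>d f\<bar> \<le> e * N f"
  shows "\<exists>c. \<forall>f\<in>F. \<bar>d f - c * L f\<bar> \<le> e * N f"
proof (cases "\<forall>f\<in>F. L f = 0")
  case True
  then show ?thesis using le by (intro exI[of _ 0]) auto
next
  case False
  then obtain f0 where f0: "f0 \<in> F" "L f0 \<noteq> 0" by blast
  define H where "H = {f \<in> F. L f = 1}"
  have "(\<lambda>x. (1 / L f0) * f0 x) \<in> H"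
    using f0 linear_form_scale[OF L f0(1), of "1 / L f0"] scale_mem[of f0 "1 / L f0"]
    by (simp add: H_def)
  then have "H \<noteq> {}" by blast
  have sep: "d f - e * N f \<le> d g + e * N g" if "f \<in> H" "g \<in> H" for f g
  proof -
    have fg: "f \<in> F" "g \<in> F" "L f = 1" "L g = 1" using that by (auto simp: H_def)
    have "d f - d g = d (\<lambda>x. f x - g x)" using linear_form_diff[OF d] fg by simp
    also have "\<dots> \<le> e * N (\<lambda>x. f x - g x)"
      using le[OF diff_mem[OF fg(1,2)]] linear_form_diff[OF L] fg by simp
    also have "\<dots> \<le> e * (N f + N g)"
      using norm_diff_le[of f g] fg e by (intro mult_left_mono) auto
    finally show ?thesis by (simp add: algebra_simps)
  qed
  define c where "c = (SUP f\<in>H. d f - e * N f)"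
  have bdd: "bdd_above ((\<lambda>f. d f - e * N f) ` H)"
    using sep \<open>H \<noteq> {}\<close> by (meson bdd_aboveI2 ex_in_conv)
  have c: "\<bar>d f - c\<bar> \<le> e * N f" if "f \<in> H" for f
  proof -
    have "d f - e * N f \<le> c" unfolding c_def using bdd that by (rule cSUP_upper2) simp
    moreover have "c \<le> d f + e * N f"
      unfolding c_def using sep that \<open>H \<noteq> {}\<close> by (intro cSUP_least) auto
    ultimately show ?thesis by linarith
  qed
  have "\<bar>d f - c * L f\<bar> \<le> e * N f" if f: "f \<in> F" for f
  proof (cases "L f = 0")
    case True
    then show ?thesis using le f by simp
  next
    case False
    define g where "g = (\<lambda>x. (1 / L f) * f x)"
    have "g \<in> H" and dg: "d g = d f / L f" and Ng: "N g = N f / \<bar>L f\<bar>"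
      using False f linear_form_scale[OF L f, of "1 / L f"] linear_form_scale[OF d f, of "1 / L f"]
        scale_mem[OF f, of "1 / L f"] norm_scale[OF f, of "1 / L f"]
      by (simp_all add: H_def g_def)
    have "\<bar>d f - c * L f\<bar> = \<bar>L f\<bar> * \<bar>d g - c\<bar>"
      using False by (simp add: dg algebra_simps flip: abs_mult)
    also have "\<dots> \<le> \<bar>L f\<bar> * (e * N g)" using c[OF \<open>g \<in> H\<close>] by (intro mult_left_mono) auto
    also have "\<dots> = e * N f" using False by (simp add: Ng)
    finally show ?thesis .
  qed
  then show ?thesis by blast
qed

end

text \<open>The distance from \<open>d\<close> to the span of the \<open>L i\<close> is the norm of \<open>d\<close> on their common kernel. Induction
on \<open>n\<close>: the hypothesis is applied on the kernel of the last form, and one extension step returns to \<open>F\<close>.\<close>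

lemma approx_by_finitely_many_forms:
  fixes n :: nat
  assumes "seminormed_function_space F N"
    and "\<And>i. i < n \<Longrightarrow> linear_form F (L i)" and "linear_form F d" and "0 \<le> e"
    and "\<And>f. f \<in> F \<Longrightarrow> (\<And>i. i < n \<Longrightarrow> L i f = 0) \<Longrightarrow> \<bar>d f\<bar> \<le> e * N f"
  shows "\<exists>c. \<forall>f\<in>F. \<bar>d f - (\<Sum>i<n. c i * L i f)\<bar> \<le> e * N f"
  using assms
proof (induction n arbitrary: F)
  case 0
  then show ?case by auto
next
  case (Suc n)
  interpret seminormed_function_space F N by fact
  let ?W = "{f \<in> F. L n f = 0}"
  have Ln: "linear_form F (L n)" using Suc.prems(2) by simp
  have "\<exists>c. \<forall>f\<in>?W. \<bar>d f - (\<Sum>i<n. c i * L i f)\<bar> \<le> e * N f"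
  proof (rule Suc.IH)
    show "seminormed_function_space ?W N" by (rule kernel_subspace[OF Ln])
    show "linear_form ?W (L i)" if "i < n" for i
      using Suc.prems(2)[of i] that linear_form_subset[of F "L i" ?W] by auto
    show "linear_form ?W d" using Suc.prems(3) linear_form_subset[of F d ?W] by auto
    show "0 \<le> e" by fact
    show "\<bar>d f\<bar> \<le> e * N f" if "f \<in> ?W" "\<And>i. i < n \<Longrightarrow> L i f = 0" for f
      using that by (intro Suc.prems(5)) (auto simp: less_Suc_eq)
  qed
  then obtain c where c: "\<And>f. f \<in> ?W \<Longrightarrow> \<bar>d f - (\<Sum>i<n. c i * L i f)\<bar> \<le> e * N f"
    by blast
  have "\<exists>b. \<forall>f\<in>F. \<bar>(d f - (\<Sum>i<n. c i * L i f)) - b * L n f\<bar> \<le> e * N f"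
  proof (rule bounded_extension_one_step[OF Ln _ \<open>0 \<le> e\<close>])
    show "linear_form F (\<lambda>f. d f - (\<Sum>i<n. c i * L i f))"
      using Suc.prems(2,3) by (intro linear_form_diff_sum) auto
  qed (use c in auto)
  then obtain b where "\<forall>f\<in>F. \<bar>(d f - (\<Sum>i<n. c i * L i f)) - b * L n f\<bar> \<le> e * N f"
    by blast
  then show ?case
    by (intro exI[of _ "c(n := b)"]) (simp add: algebra_simps)
qed

text \<open>Write \<open>w x\<close> for the combination of the \<open>L i\<close> that is close to evaluation at \<open>x\<close>. If \<open>f\<close> vanishes at
barycentric points of \<open>w\<close>, then each \<open>w (x i) f\<close> is at most \<open>e * N f\<close> in modulus, hence \<open>w y f\<close> is at most
\<open>2 * n\<close> times that, and passing from \<open>w y f\<close> to \<open>f y\<close> adds the term once more.\<close>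

lemma sampling_points:
  fixes n :: nat
  assumes space: "seminormed_function_space F N"
    and L: "\<And>i. i < n \<Longrightarrow> linear_form F (L i)" and e: "0 \<le> e"
    and le: "\<And>f x. f \<in> F \<Longrightarrow> (\<And>i. i < n \<Longrightarrow> L i f = 0) \<Longrightarrow> x \<in> X \<Longrightarrow> \<bar>f x\<bar> \<le> e * N f"
    and bounded: "\<And>f. f \<in> F \<Longrightarrow> \<exists>C. \<forall>x\<in>X. \<bar>f x\<bar> \<le> C"
  obtains k x where "k \<le> n" and "\<And>i::nat. i < k \<Longrightarrow> x i \<in> X"
    and "\<And>f y. f \<in> F \<Longrightarrow> (\<And>i. i < k \<Longrightarrow> f (x i) = 0) \<Longrightarrow> y \<in> X \<Longrightarrow>
           \<bar>f y\<bar> \<le> (2 * real n + 1) * (e * N f)"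
proof -
  interpret seminormed_function_space F N by (rule space)
  have "\<exists>c. \<forall>f\<in>F. \<bar>f x - (\<Sum>i<n. c i * L i f)\<bar> \<le> e * N f" if "x \<in> X" for x
    using le[OF _ _ that]
    by (intro approx_by_finitely_many_forms[OF space L _ e]) (auto simp: linear_form_def)
  then obtain c where c: "\<And>x f. x \<in> X \<Longrightarrow> f \<in> F \<Longrightarrow> \<bar>f x - (\<Sum>i<n. c x i * L i f)\<bar> \<le> e * N f"
    by metis
  define w where "w x f = (\<Sum>i<n. c x i * L i f)" for x f
  have close: "\<bar>f x - w x f\<bar> \<le> e * N f" if "x \<in> X" "f \<in> F" for x f
    using c that by (simp add: w_def)
  have w_bounded: "\<exists>C. \<forall>x\<in>X. \<bar>w x f\<bar> \<le> C" if f: "f \<in> F" for f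
  proof -
    obtain C where "\<forall>x\<in>X. \<bar>f x\<bar> \<le> C" using bounded[OF f] by blast
    then have "\<forall>x\<in>X. \<bar>w x f\<bar> \<le> C + e * N f" using close f by fastforce
    then show ?thesis by blast
  qed
  obtain k x
    where kn: "k \<le> n" and x: "\<And>i::nat. i < k \<Longrightarrow> x i \<in> X"
      and comb: "\<And>y. y \<in> X \<Longrightarrow>
        \<exists>\<alpha>. (\<forall>i<k. \<bar>\<alpha> i\<bar> \<le> 2) \<and> (\<forall>f\<in>F. w y f = (\<Sum>i<k. \<alpha> i * w (x i) f))"
    by (rule barycentric_points[of F X w c L n]) (use w_bounded w_def in auto)
  show ?thesis
  proof (rule that[of k x])
    show "\<bar>f y\<bar> \<le> (2 * real n + 1) * (e * N f)"
      if f: "f \<in> F" and zero: "\<And>i. i < k \<Longrightarrow> f (x i) = 0" and y: "y \<in> X" for f y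
    proof -
      have eN: "0 \<le> e * N f" using e norm_nonneg[OF f] by simp
      obtain \<alpha> where \<alpha>: "\<And>i. i < k \<Longrightarrow> \<bar>\<alpha> i\<bar> \<le> 2" and "w y f = (\<Sum>i<k. \<alpha> i * w (x i) f)"
        using comb[OF y] f by blast
      then have "\<bar>w y f\<bar> \<le> (\<Sum>i<k. \<bar>\<alpha> i * w (x i) f\<bar>)" by simp
      also have "\<dots> \<le> (\<Sum>i<k. 2 * (e * N f))"
      proof (rule sum_mono)
        fix i assume "i \<in> {..<k}"
        then have i: "i < k" by simp
        have "\<bar>w (x i) f\<bar> \<le> e * N f" using close[OF x[OF i] f] zero[OF i] by simp
        then show "\<bar>\<alpha> i * w (x i) f\<bar> \<le> 2 * (e * N f)"
          unfolding abs_mult using \<alpha>[OF i] by (intro mult_mono) auto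
      qed
      also have "\<dots> = 2 * real k * (e * N f)" by simp
      also have "\<dots> \<le> 2 * real n * (e * N f)" using kn eN by (intro mult_right_mono) auto
      finally show ?thesis using close[OF y f] by (simp add: algebra_simps)
    qed
  qed (use kn x in auto)
qed

section \<open>Function values against arbitrary functionals\<close>

lemma Linf_norm_AE: "AE x in M. ennreal \<bar>f x\<bar> \<le> Lp_norm M \<infinity> f"
  by (simp add: Lp_norm_def esssup_AE)

lemma Linf_norm_leI:
  assumes "f \<in> borel_measurable M" and "AE x in M. ennreal \<bar>f x\<bar> \<le> c"
  shows "Lp_norm M \<infinity> f \<le> c"
  using assms by (auto simp: Lp_norm_def intro!: esssup_I)

lemma Linf_norm_leD:
  assumes "Lp_norm M \<infinity> f \<le> ennreal E" and "0 \<le> E"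
  shows "AE x in M. \<bar>f x\<bar> \<le> E"
  using Linf_norm_AE[of f M] by eventually_elim (use assms order_trans in fastforce)

lemma banach_imp_seminormed: "banach_function_space \<Omega> F N \<Longrightarrow> seminormed_function_space F N"
  by (simp add: banach_function_space_def seminormed_function_space_def)

lemma all_info_iff:
  "L \<in> all_info F N \<longleftrightarrow> linear_form F L \<and> (\<exists>C. \<forall>f\<in>F. \<bar>L f\<bar> \<le> C * N f)"
  by (auto simp: all_info_def linear_form_def)

lemma info_on_kernel:
  assumes "\<And>i. i < n \<Longrightarrow> S (replicate i 0) f = 0"
  shows "info S f n = replicate n 0"
  using assms by (induction n) (simp_all add: replicate_append_same)

text \<open>Even an adaptive nonlinear algorithm cannot distinguish \<open>f\<close> from \<open>- f\<close> when all its information is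
zero. The functionals are those it uses along the path of zero answers; as it returns the same \<open>h\<close> for
both functions, the triangle inequality bounds \<open>f\<close> by the error.\<close>

lemma Linf_norm_le_on_kernel:
  assumes space: "banach_function_space (space M) F N" and emb: "embedded_in_Lp M \<infinity> F N"
    and A: "A \<in> algorithms M \<infinity> (all_info F N) n"
    and err: "wor_error M \<infinity> F N A \<le> ennreal E" and "0 \<le> E"
  obtains L where "\<And>i. i < n \<Longrightarrow> L i \<in> all_info F N"
    and "\<And>f. f \<in> F \<Longrightarrow> (\<And>i. i < n \<Longrightarrow> L i f = 0) \<Longrightarrow> Lp_norm M \<infinity> f \<le> ennreal (E * N f)"
proof -
  interpret banach_function_space "space M" F N by (rule space)
  obtain S \<phi> where A_eq: "A = (\<lambda>f. \<phi> (info S f n))"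
    and S: "\<And>ys. length ys < n \<Longrightarrow> S ys \<in> all_info F N"
    using A by (auto simp: algorithms_def)
  show ?thesis
  proof (rule that[of "\<lambda>i. S (replicate i 0)"])
    show info: "S (replicate i 0) \<in> all_info F N" if "i < n" for i using S that by simp
    show "Lp_norm M \<infinity> f \<le> ennreal (E * N f)"
      if f: "f \<in> F" and ker: "\<And>i. i < n \<Longrightarrow> S (replicate i 0) f = 0" for f
    proof -
      have meas: "f \<in> borel_measurable M" using emb f by (auto simp: embedded_in_Lp_def Lp_def)
      show ?thesis
      proof (cases "N f = 0")
        case True
        then have "f = (\<lambda>x. 0)" using norm_eq_0_iff[OF f] by simp
        then show ?thesis using meas by (intro Linf_norm_leI) auto
      next
        case False
        then have pos: "0 < N f" using norm_nonneg[OF f] by simp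
        define h where "h = \<phi> (replicate n 0)"
        have close: "AE x in M. \<bar>t * f x - h x\<bar> \<le> E" if t: "\<bar>t\<bar> * N f = 1" for t
        proof -
          have "info S (\<lambda>x. t * f x) n = replicate n 0"
          proof (rule info_on_kernel)
            fix i assume "i < n"
            then show "S (replicate i 0) (\<lambda>x. t * f x) = 0"
              using info[of i] ker f by (auto simp: all_info_def)
          qed
          then have "A (\<lambda>x. t * f x) = h" by (simp add: A_eq h_def)
          moreover have "(\<lambda>x. t * f x) \<in> {f \<in> F. N f \<le> 1}"
            using scale_mem[OF f] norm_scale[OF f] t by simp
          then have "Lp_norm M \<infinity> (\<lambda>x. t * f x - A (\<lambda>x. t * f x) x) \<le> wor_error M \<infinity> F N A"
            unfolding wor_error_def by (rule SUP_upper)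
          ultimately show ?thesis using err \<open>0 \<le> E\<close> by (intro Linf_norm_leD) auto
        qed
        have "AE x in M. \<bar>(1 / N f) * f x - h x\<bar> \<le> E" using pos by (intro close) simp
        moreover have "AE x in M. \<bar>(- 1 / N f) * f x - h x\<bar> \<le> E" using pos by (intro close) simp
        ultimately have "AE x in M. \<bar>f x\<bar> \<le> E * N f"
        proof eventually_elim
          case (elim x)
          then have "f x / N f \<le> E" and "- (f x / N f) \<le> E" by (simp_all add: abs_le_iff)
          then show ?case using pos by (simp add: abs_le_iff field_simps)
        qed
        then show ?thesis using meas by (intro Linf_norm_leI) (auto intro: ennreal_leI)
      qed
    qed
  qed
qed

lemma info_eval: "info (\<lambda>ys f. f (x (length ys))) f n = map (\<lambda>i. f (x i)) [0..<n]"
  by (induction n) simp_all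

text \<open>The algorithm returns any element of the unit ball with the observed values. Its difference from \<open>f\<close>
has norm at most 2 and vanishes at the sampling points.\<close>

lemma std_error_le:
  assumes space: "banach_function_space (space M) F N" and emb: "embedded_in_Lp M \<infinity> F N"
    and x: "\<And>i. i < n \<Longrightarrow> x i \<in> space M" and "0 \<le> K"
    and K: "\<And>f. f \<in> F \<Longrightarrow> (\<And>i. i < n \<Longrightarrow> f (x i) = 0) \<Longrightarrow> Lp_norm M \<infinity> f \<le> ennreal (K * N f)"
  shows "min_error M \<infinity> F N (std_info (space M)) n \<le> ennreal (2 * K)"
proof -
  interpret banach_function_space "space M" F N by (rule space)
  interpret s: seminormed_function_space F N by (rule banach_imp_seminormed[OF space])
  define Q where "Q ys f \<longleftrightarrow> f \<in> F \<and> N f \<le> 1 \<and> map (\<lambda>i. f (x i)) [0..<n] = ys" for ys f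
  define \<phi> where "\<phi> ys = (if \<exists>f. Q ys f then SOME f. Q ys f else (\<lambda>x. 0))" for ys
  define A where "A = (\<lambda>f. \<phi> (info (\<lambda>ys f. f (x (length ys))) f n))"
  have "F \<subseteq> Lp M \<infinity>" using emb by (simp add: embedded_in_Lp_def)
  have \<phi>F: "\<phi> ys \<in> F" for ys
  proof (cases "\<exists>f. Q ys f")
    case True
    then have "Q ys (\<phi> ys)" unfolding \<phi>_def by (metis someI_ex)
    then show ?thesis by (simp add: Q_def)
  qed (simp add: \<phi>_def zero_mem)
  have "A \<in> algorithms M \<infinity> (std_info (space M)) n"
    unfolding algorithms_def A_def using x \<phi>F \<open>F \<subseteq> Lp M \<infinity>\<close>
    by (auto simp: std_info_def intro!: exI[of _ "\<lambda>ys f. f (x (length ys))"] exI[of _ \<phi>])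
  then have "min_error M \<infinity> F N (std_info (space M)) n \<le> wor_error M \<infinity> F N A"
    unfolding min_error_def by (rule INF_lower)
  also have "\<dots> \<le> ennreal (2 * K)"
    unfolding wor_error_def
  proof (rule SUP_least)
    fix f assume "f \<in> {f \<in> F. N f \<le> 1}"
    then have f: "f \<in> F" "N f \<le> 1" by auto
    define ys where "ys = map (\<lambda>i. f (x i)) [0..<n]"
    have "Q ys f" using f by (simp add: Q_def ys_def)
    then have Q: "Q ys (\<phi> ys)" unfolding \<phi>_def by (metis someI_ex)
    have Af: "A f = \<phi> ys" by (simp add: A_def info_eval ys_def)
    define h where "h = (\<lambda>x. f x - \<phi> ys x)"
    have h: "h \<in> F" unfolding h_def using s.diff_mem f \<phi>F by blast
    have "N h \<le> 2"
      unfolding h_def using s.norm_diff_le[OF f(1) \<phi>F, of ys] f(2) Q by (auto simp: Q_def)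
    have "h (x i) = 0" if "i < n" for i
      using Q that by (auto simp: Q_def ys_def h_def)
    then have "Lp_norm M \<infinity> h \<le> ennreal (K * N h)" using K h by blast
    also have "\<dots> \<le> ennreal (2 * K)"
      using mult_left_mono[OF \<open>N h \<le> 2\<close> \<open>0 \<le> K\<close>] by (intro ennreal_leI) simp
    finally show "Lp_norm M \<infinity> (\<lambda>x. f x - A f x) \<le> ennreal (2 * K)"
      by (simp add: Af h_def)
  qed
  finally show ?thesis .
qed

lemma ennreal_le_mult_INF:
  assumes "0 < c" and "\<And>i. i \<in> I \<Longrightarrow> x \<le> ennreal c * f i"
  shows "x \<le> ennreal c * (INF i\<in>I. f i)"
proof -
  have inv: "ennreal (1 / c) * ennreal c = 1"
    using assms(1) by (simp flip: ennreal_mult)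
  have "ennreal (1 / c) * x \<le> f i" if "i \<in> I" for i
  proof -
    have "ennreal (1 / c) * x \<le> ennreal (1 / c) * (ennreal c * f i)"
      using assms(2)[OF that] by (rule mult_left_mono) simp
    then show ?thesis by (simp add: inv flip: mult.assoc)
  qed
  then have "ennreal (1 / c) * x \<le> (INF i\<in>I. f i)" by (rule INF_greatest)
  then have "ennreal c * (ennreal (1 / c) * x) \<le> ennreal c * (INF i\<in>I. f i)"
    by (rule mult_left_mono) simp
  then show ?thesis by (simp add: inv mult.commute[of "ennreal c"] flip: mult.assoc)
qed

text \<open>An algorithm with error \<open>E\<close> supplies the forms for \<open>sampling_points\<close> with \<open>e = E\<close>, where \<open>X\<close> is the
domain without the common null set; the latter is what turns bounds on \<open>L\<^sub>\<infinity>\<close> norms into bounds at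
the points. If the domain were empty, there would be no algorithm using function values at all, and the left hand
side would be infinite for \<open>n > 0\<close>.\<close>

theorem std_error_le_all_error:
  assumes space: "banach_function_space (space M) F N" and emb: "embedded_in_Lp M \<infinity> F N"
    and common: "common_null_set M F" and "space M \<noteq> {}"
  shows "min_error M \<infinity> F N (std_info (space M)) n
    \<le> ennreal (4 * real n + 2) * min_error M \<infinity> F N (all_info F N) n"
proof -
  interpret banach_function_space "space M" F N by (rule space)
  interpret s: seminormed_function_space F N by (rule banach_imp_seminormed[OF space])
  let ?e = "min_error M \<infinity> F N (std_info (space M)) n"
  have "?e \<le> ennreal (4 * real n + 2) * wor_error M \<infinity> F N A"
    if A: "A \<in> algorithms M \<infinity> (all_info F N) n" for A
  proof (cases "wor_error M \<infinity> F N A")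
    case (real E)
    obtain L where L: "\<And>i. i < n \<Longrightarrow> L i \<in> all_info F N"
      and ker: "\<And>f. f \<in> F \<Longrightarrow> (\<And>i. i < n \<Longrightarrow> L i f = 0) \<Longrightarrow> Lp_norm M \<infinity> f \<le> ennreal (E * N f)"
      using Linf_norm_le_on_kernel[OF space emb A _ real(1)] real(2) by (metis order_refl)
    obtain Z where Z: "Z \<in> null_sets M"
      and le: "\<And>f x. f \<in> F \<Longrightarrow> x \<in> space M - Z \<Longrightarrow> ennreal \<bar>f x\<bar> \<le> Lp_norm M \<infinity> f"
      using common by (auto simp: common_null_set_def)
    have meas: "f \<in> borel_measurable M" if "f \<in> F" for f
      using emb that by (auto simp: embedded_in_Lp_def Lp_def)
    obtain k x where kn: "k \<le> n" and x: "\<And>i::nat. i < k \<Longrightarrow> x i \<in> space M - Z"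
      and pts: "\<And>f y. f \<in> F \<Longrightarrow> (\<And>i. i < k \<Longrightarrow> f (x i) = 0) \<Longrightarrow> y \<in> space M - Z \<Longrightarrow>
           \<bar>f y\<bar> \<le> (2 * real n + 1) * (E * N f)"
    proof (rule sampling_points[of F N n L E "space M - Z"])
      show "seminormed_function_space F N" by (rule s.seminormed_function_space_axioms)
      show "linear_form F (L i)" if "i < n" for i using L[OF that] by (simp add: all_info_iff)
      show "0 \<le> E" by fact
      show "\<bar>f x\<bar> \<le> E * N f"
        if "f \<in> F" "\<And>i. i < n \<Longrightarrow> L i f = 0" "x \<in> space M - Z" for f x
      proof -
        have "ennreal \<bar>f x\<bar> \<le> ennreal (E * N f)" using le ker that by (metis order_trans)
        then show ?thesis using norm_nonneg[OF \<open>f \<in> F\<close>] \<open>0 \<le> E\<close> by (simp add: ennreal_le_iff)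
      qed
      show "\<exists>C. \<forall>x\<in>space M - Z. \<bar>f x\<bar> \<le> C" if f: "f \<in> F" for f
      proof -
        have "Lp_norm M \<infinity> f < \<infinity>" using emb f by (auto simp: embedded_in_Lp_def Lp_def)
        then obtain C where "Lp_norm M \<infinity> f = ennreal C" "0 \<le> C"
          by (cases "Lp_norm M \<infinity> f") auto
        then show ?thesis using le[OF f] by (intro exI[of _ C]) (metis ennreal_le_iff)
      qed
    qed auto
    obtain x0 where "x0 \<in> space M" using \<open>space M \<noteq> {}\<close> by blast
    \<comment> \<open>Unused evaluations are spent at an arbitrary point.\<close>
    define x' where "x' i = (if i < k then x i else x0)" for i
    have "?e \<le> ennreal (2 * ((2 * real n + 1) * E))"
    proof (rule std_error_le[OF space emb])
      show "x' i \<in> space M" if "i < n" for i using x \<open>x0 \<in> space M\<close> by (auto simp: x'_def)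
      show "0 \<le> (2 * real n + 1) * E" using \<open>0 \<le> E\<close> by simp
      show "Lp_norm M \<infinity> f \<le> ennreal ((2 * real n + 1) * E * N f)"
        if f: "f \<in> F" and zero: "\<And>i. i < n \<Longrightarrow> f (x' i) = 0" for f
      proof (rule Linf_norm_leI[OF meas[OF f]])
        have "f (x i) = 0" if "i < k" for i using zero[of i] that kn by (simp add: x'_def)
        then have "\<bar>f y\<bar> \<le> (2 * real n + 1) * (E * N f)" if "y \<in> space M - Z" for y
          using pts[OF f _ that] by blast
        then have "ennreal \<bar>f y\<bar> \<le> ennreal ((2 * real n + 1) * E * N f)" if "y \<in> space M - Z" for y
          using that by (intro ennreal_leI) (simp add: mult.assoc)
        then show "AE y in M. ennreal \<bar>f y\<bar> \<le> ennreal ((2 * real n + 1) * E * N f)"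
          by (intro AE_I'[OF Z]) auto
      qed
    qed
    also have "2 * ((2 * real n + 1) * E) = (4 * real n + 2) * E" by (simp add: algebra_simps)
    also have "ennreal \<dots> = ennreal (4 * real n + 2) * ennreal E"
      using \<open>0 \<le> E\<close> by (intro ennreal_mult) auto
    finally show ?thesis by (simp only: real)
  qed (simp add: ennreal_mult_top)
  then show ?thesis
    unfolding min_error_def[of M \<infinity> F N "all_info F N"] by (intro ennreal_le_mult_INF) auto
qed

section \<open>A common null set for Hilbert spaces\<close>

context hilbert_function_space
begin

lemma seminormed: "seminormed_function_space F N"
  by (rule banach_imp_seminormed) (rule banach_function_space_axioms)

lemma parallelogram:
  assumes f: "f \<in> F" and g: "g \<in> F"
  shows "(N (\<lambda>x. f x + g x))\<^sup>2 + (N (\<lambda>x. f x - g x))\<^sup>2 = 2 * (N f)\<^sup>2 + 2 * (N g)\<^sup>2"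
proof -
  obtain ip :: "('a \<Rightarrow> real) \<Rightarrow> ('a \<Rightarrow> real) \<Rightarrow> real" where
    sym: "\<And>f g. f \<in> F \<Longrightarrow> g \<in> F \<Longrightarrow> ip f g = ip g f" and
    add: "\<And>f g h. f \<in> F \<Longrightarrow> g \<in> F \<Longrightarrow> h \<in> F \<Longrightarrow> ip (\<lambda>x. f x + g x) h = ip f h + ip g h" and
    scale: "\<And>c f g. f \<in> F \<Longrightarrow> g \<in> F \<Longrightarrow> ip (\<lambda>x. c * f x) g = c * ip f g" and
    N: "\<And>f. f \<in> F \<Longrightarrow> (N f)\<^sup>2 = ip f f"
  proof -
    from ex_inner obtain ip :: "('a \<Rightarrow> real) \<Rightarrow> ('a \<Rightarrow> real) \<Rightarrow> real" where
      "\<forall>f\<in>F. \<forall>g\<in>F. ip f g = ip g f"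
      "\<forall>f\<in>F. \<forall>g\<in>F. \<forall>h\<in>F. ip (\<lambda>x. f x + g x) h = ip f h + ip g h"
      "\<forall>c. \<forall>f\<in>F. \<forall>g\<in>F. ip (\<lambda>x. c * f x) g = c * ip f g"
      "\<forall>f\<in>F. (N f)\<^sup>2 = ip f f"
      by (elim exE conjE)
    then show thesis by (intro that[of ip]) simp_all
  qed
  have expand: "(N (\<lambda>x. f x + h x))\<^sup>2 = (N f)\<^sup>2 + 2 * ip h f + (N h)\<^sup>2" if h: "h \<in> F" for h
  proof -
    let ?s = "\<lambda>x. f x + h x"
    have s: "?s \<in> F" using add_mem f h by blast
    have "(N ?s)\<^sup>2 = ip f ?s + ip h ?s" using N s add f h by simp
    also have "\<dots> = ip ?s f + ip ?s h" using sym s f h by simp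
    also have "\<dots> = ip f f + ip h f + (ip f h + ip h h)" using add f h by simp
    finally show ?thesis using N sym f h by simp
  qed
  have mg: "(\<lambda>x. - 1 * g x) \<in> F" using scale_mem[OF g, of "- 1"] .
  have "N (\<lambda>x. - 1 * g x) = N g" using norm_scale[OF g, of "- 1"] by simp
  moreover have "ip (\<lambda>x. - 1 * g x) f = - ip g f" using scale[OF g f, of "- 1"] by simp
  ultimately show ?thesis using expand[OF g] expand[OF mg] by simp
qed

text \<open>Elements \<open>s k\<close> of nearly minimal norm in \<open>C k\<close> form a Cauchy sequence: for \<open>k \<le> m\<close> the midpoint of
\<open>s k\<close> and \<open>s m\<close> lies in \<open>C k\<close>, so it cannot be much shorter than \<open>s k\<close>, and the parallelogram law
forces \<open>s k\<close> and \<open>s m\<close> to be close. This substitutes for weak compactness of bounded sets.\<close>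

lemma nested_closed_convex_Int:
  fixes C :: "nat \<Rightarrow> ('a \<Rightarrow> real) set"
  assumes sub: "\<And>k. C k \<subseteq> F" and ne: "\<And>k. C k \<noteq> {}" and dec: "\<And>k m. k \<le> m \<Longrightarrow> C m \<subseteq> C k"
    and mid: "\<And>k f g. f \<in> C k \<Longrightarrow> g \<in> C k \<Longrightarrow> (\<lambda>x. (1/2) * (f x + g x)) \<in> C k"
    and bounded: "\<And>k f. f \<in> C k \<Longrightarrow> N f \<le> R"
    and closed: "\<And>k s f. (\<And>n::nat. s n \<in> C k) \<Longrightarrow> f \<in> F \<Longrightarrow>
      (\<lambda>n. N (\<lambda>x. s n x - f x)) \<longlonglongrightarrow> 0 \<Longrightarrow> f \<in> C k"
  obtains f where "\<And>k. f \<in> C k"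
proof -
  define t where "t k = (INF f\<in>C k. (N f)\<^sup>2)" for k
  have bdd: "bdd_below ((\<lambda>f. (N f)\<^sup>2) ` C k)" for k
    by (rule bdd_belowI[of _ 0]) auto
  have t_le: "t k \<le> (N f)\<^sup>2" if "f \<in> C k" for f k
    unfolding t_def using bdd that by (rule cINF_lower)
  have "incseq t"
    unfolding t_def by (rule incseq_SucI, rule cINF_superset_mono[OF ne bdd dec]) simp_all
  moreover have "\<forall>k. t k \<le> R\<^sup>2"
  proof
    fix k
    obtain f where f: "f \<in> C k" using ne by blast
    have "(N f)\<^sup>2 \<le> R\<^sup>2" using bounded[OF f] norm_nonneg sub f by (intro power_mono) auto
    then show "t k \<le> R\<^sup>2" using t_le[OF f] by simp
  qed
  ultimately obtain T where T: "t \<longlonglongrightarrow> T" and tT: "\<And>k. t k \<le> T"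
    by (rule incseq_convergent[of t "R\<^sup>2"]) auto
  define q where "q k = 1 / real (Suc k)" for k
  have q_pos: "0 < q k" for k by (simp add: q_def)
  have "\<exists>f\<in>C k. (N f)\<^sup>2 < t k + q k" for k
    proof -
    have "(INF f\<in>C k. (N f)\<^sup>2) < t k + q k" using q_pos[of k] unfolding t_def by simp
    then show ?thesis by (subst (asm) cINF_less_iff[OF ne bdd])
  qed
  then obtain s where sC: "\<And>k. s k \<in> C k" and s_le: "\<And>k. (N (s k))\<^sup>2 < t k + q k"
    by metis
  have sF: "s k \<in> F" for k using sC sub by blast
  define \<delta> where "\<delta> k = 2 * (T - t k) + 4 * q k" for k
  have "q \<longlonglongrightarrow> 0"
    unfolding q_def using LIMSEQ_Suc[OF lim_const_over_n[of "1::real"]] .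
  then have "\<delta> \<longlonglongrightarrow> 2 * (T - T) + 4 * 0"
    unfolding \<delta>_def by (intro tendsto_intros T)
  then have \<delta>: "\<delta> \<longlonglongrightarrow> 0" by simp
  have dist: "(N (\<lambda>x. s k x - s m x))\<^sup>2 \<le> \<delta> k" if "k \<le> m" for k m
  proof -
    have "s m \<in> C k" using sC dec[OF that] by blast
    then have "t k \<le> (N (\<lambda>x. (1/2) * (s k x + s m x)))\<^sup>2"
      using sC mid t_le by blast
    also have "\<dots> = (N (\<lambda>x. s k x + s m x))\<^sup>2 / 4"
      by (subst norm_scale) (auto simp: add_mem sF power_divide)
    finally have "(N (\<lambda>x. s k x - s m x))\<^sup>2 \<le> 2 * (N (s k))\<^sup>2 + 2 * (N (s m))\<^sup>2 - 4 * t k"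
      using parallelogram[OF sF[of k] sF[of m]] by simp
    also have "\<dots> \<le> 2 * (t k + q k) + 2 * (T + q k) - 4 * t k"
    proof -
      have "q m \<le> q k" unfolding q_def using that by (intro divide_left_mono) auto
      then have "(N (s m))\<^sup>2 \<le> T + q k" using s_le[of m] tT[of m] by linarith
      then show ?thesis using s_le[of k] by (intro diff_right_mono add_mono) simp_all
    qed
    also have "\<dots> = \<delta> k" by (simp add: \<delta>_def)
    finally show ?thesis .
  qed
  have swap: "N (\<lambda>x. s k x - s m x) = N (\<lambda>x. s m x - s k x)" for k m
    using norm_scale[OF seminormed_function_space.diff_mem[OF seminormed sF sF], of "- 1" m k] by simp
  have "\<exists>K. \<forall>m\<ge>K. \<forall>n\<ge>K. N (\<lambda>x. s m x - s n x) < e" if "0 < e" for e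
  proof -
    have "\<forall>\<^sub>F k in sequentially. \<delta> k < e\<^sup>2" using \<delta> that by (intro order_tendstoD) auto
    then obtain K where K: "\<And>k. K \<le> k \<Longrightarrow> \<delta> k < e\<^sup>2" by (auto simp: eventually_sequentially)
    have "N (\<lambda>x. s m x - s n x) < e" if mn: "K \<le> m" "K \<le> n" for m n
    proof -
      have "(N (\<lambda>x. s m x - s n x))\<^sup>2 < e\<^sup>2"
      proof (cases "m \<le> n")
        case True
        show ?thesis by (rule le_less_trans[OF dist[OF True] K[OF mn(1)]])
      next
        case False
        then have "n \<le> m" by simp
        show ?thesis
          unfolding swap[of m n] by (rule le_less_trans[OF dist[OF \<open>n \<le> m\<close>] K[OF mn(2)]])
      qed
      then show ?thesis using \<open>0 < e\<close> by (simp add: power2_less_imp_less)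
    qed
    then show ?thesis by blast
  qed
  from complete[OF sF this] obtain f where f: "f \<in> F" and lim: "(\<lambda>n. N (\<lambda>x. s n x - f x)) \<longlonglongrightarrow> 0"
    by blast
  have "f \<in> C k" for k
  proof (rule closed[OF _ f])
    show "s (n + k) \<in> C k" for n using sC dec[of k "n + k"] by auto
    show "(\<lambda>n. N (\<lambda>x. s (n + k) x - f x)) \<longlonglongrightarrow> 0" using LIMSEQ_ignore_initial_segment[OF lim] .
  qed
  then show ?thesis by (rule that)
qed

lemma all_info_tendsto:
  assumes "L \<in> all_info F N" and "\<And>n. s n \<in> F" and "f \<in> F"
    and "(\<lambda>n. N (\<lambda>x. s n x - f x)) \<longlonglongrightarrow> 0"
  shows "(\<lambda>n. L (s n)) \<longlonglongrightarrow> L f"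
proof -
  interpret s: seminormed_function_space F N by (rule seminormed)
  obtain C where lin: "linear_form F L" and C: "\<And>f. f \<in> F \<Longrightarrow> \<bar>L f\<bar> \<le> C * N f"
    using assms(1) unfolding all_info_iff by blast
  have le: "\<bar>L (s n) - L f\<bar> \<le> C * N (\<lambda>x. s n x - f x)" for n
    using C[OF s.diff_mem[OF assms(2)[of n] assms(3)]]
    unfolding s.linear_form_diff[OF lin assms(2)[of n] assms(3)] .
  have "(\<lambda>n. C * N (\<lambda>x. s n x - f x)) \<longlonglongrightarrow> 0"
    by (rule tendsto_mult_right_zero[OF assms(4)])
  then have "(\<lambda>n. L (s n) - L f) \<longlonglongrightarrow> 0"
    by (rule Lim_null_comparison[OF always_eventually[OF allI[OF le[folded real_norm_def]]]])
  then show ?thesis by (rule LIM_zero_cancel)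
qed

lemma eval_in_all_info: "x \<in> \<Omega> \<Longrightarrow> (\<lambda>f. f x) \<in> all_info F N"
  using eval_continuous by (auto simp: std_info_def)

text \<open>A bounded sequence that tends to zero under a total family of functionals tends to zero weakly.
Otherwise, for some \<open>\<delta> > 0\<close>, the elements of norm at most \<open>R\<close> on which the first functionals are small and
whose value at \<open>x\<close> is at least \<open>\<delta>\<close> form nested closed convex sets, all nonempty. A common element is
annihilated by the total family, although it does not vanish at \<open>x\<close>.\<close>

lemma eval_tendsto_zero:
  fixes L :: "nat \<Rightarrow> ('a \<Rightarrow> real) \<Rightarrow> real"
  assumes L: "\<And>i. L i \<in> all_info F N"
    and total: "\<And>f. f \<in> F \<Longrightarrow> (\<And>i. L i f = 0) \<Longrightarrow> f = (\<lambda>x. 0)"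
    and h: "\<And>k::nat. h k \<in> F" and R: "\<And>k. N (h k) \<le> R"
    and lim: "\<And>i. (\<lambda>k. L i (h k)) \<longlonglongrightarrow> 0" and x: "x \<in> \<Omega>"
  shows "(\<lambda>k. h k x) \<longlonglongrightarrow> 0"
proof (rule ccontr)
  assume "\<not> (\<lambda>k. h k x) \<longlonglongrightarrow> 0"
  then obtain \<delta> where "0 < \<delta>" and freq: "\<exists>\<^sub>F k in sequentially. \<delta> \<le> \<bar>h k x\<bar>"
    by (auto simp: tendsto_iff dist_real_def frequently_def not_le)
  define C where "C k = {f \<in> F. N f \<le> R \<and> (\<forall>i\<le>k. \<bar>L i f\<bar> \<le> 1 / real (Suc k)) \<and> \<delta> \<le> f x}" for k
  have Lin: "linear_form F (L i)" for i using L by (simp add: all_info_iff)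
  have "\<exists>f. \<forall>k. f \<in> C k"
  proof (rule nested_closed_convex_Int[of C R])
    show "C k \<subseteq> F" for k by (auto simp: C_def)
    show "N f \<le> R" if "f \<in> C k" for f k using that by (simp add: C_def)
    show "C m \<subseteq> C k" if "k \<le> m" for k m
    proof -
      have le: "1 / real (Suc m) \<le> 1 / real (Suc k)"
        using that by (intro divide_left_mono) auto
      have "\<bar>L i f\<bar> \<le> 1 / real (Suc k)" if "f \<in> C m" "i \<le> k" for f i
        using that \<open>k \<le> m\<close> by (intro order_trans[OF _ le]) (simp add: C_def)
      then show ?thesis by (auto simp: C_def)
    qed
    show "C k \<noteq> {}" for k
    proof -
      have "\<forall>\<^sub>F j in sequentially. \<bar>L i (h j)\<bar> < 1 / real (Suc k)" for i
        using tendstoD[OF lim[of i], of "1 / real (Suc k)"] by simp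
      then have "\<forall>\<^sub>F j in sequentially. \<forall>i\<in>{..k}. \<bar>L i (h j)\<bar> < 1 / real (Suc k)"
        by (intro eventually_ball_finite) auto
      from frequently_ex[OF frequently_eventually_frequently[OF freq this]]
      obtain j where "\<delta> \<le> \<bar>h j x\<bar> \<and> (\<forall>i\<in>{..k}. \<bar>L i (h j)\<bar> < 1 / real (Suc k))" ..
      then have j: "\<delta> \<le> \<bar>h j x\<bar>" "\<And>i. i \<le> k \<Longrightarrow> \<bar>L i (h j)\<bar> < 1 / real (Suc k)"
        by auto
      \<comment> \<open>The sign turns a large modulus at \<open>x\<close> into a large value.\<close>
      define f where "f = (\<lambda>y. sgn (h j x) * h j y)"
      have a: "\<bar>sgn (h j x)\<bar> = 1" using j(1) \<open>0 < \<delta>\<close> by (cases "h j x = 0") (auto simp: sgn_if)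
      have "f \<in> F" unfolding f_def by (rule scale_mem[OF h])
      moreover have "N f = N (h j)" unfolding f_def norm_scale[OF h] a by simp
      moreover have "f x = \<bar>h j x\<bar>" by (simp add: f_def abs_sgn mult.commute)
      moreover have "\<bar>L i f\<bar> = \<bar>L i (h j)\<bar>" for i
        unfolding f_def using linear_form_scale[OF Lin h] a by (simp add: abs_mult)
      ultimately have "f \<in> C k" using j R[of j] by (auto simp: C_def less_imp_le)
      then show ?thesis by blast
    qed
    show "(\<lambda>x. (1/2) * (f x + g x)) \<in> C k" if "f \<in> C k" "g \<in> C k" for k f g
    proof -
      have fg: "f \<in> F" "g \<in> F" "N f \<le> R" "N g \<le> R" "\<delta> \<le> f x" "\<delta> \<le> g x"
        and Lfg: "\<And>i. i \<le> k \<Longrightarrow> \<bar>L i f\<bar> \<le> 1 / real (Suc k) \<and> \<bar>L i g\<bar> \<le> 1 / real (Suc k)"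
        using that by (auto simp: C_def)
      have "N (\<lambda>x. (1/2) * (f x + g x)) \<le> R"
        using norm_scale[OF add_mem[OF fg(1,2)], of "1/2"] norm_triangle[OF fg(1,2)] fg by simp
      moreover have "\<bar>L i (\<lambda>x. (1/2) * (f x + g x))\<bar> \<le> 1 / real (Suc k)" if "i \<le> k" for i
        using linear_form_scale[OF Lin add_mem[OF fg(1,2)], of i "1/2"]
          linear_form_add[OF Lin fg(1,2), of i] Lfg[OF that] by (simp add: abs_le_iff)
      moreover have "(\<lambda>x. (1/2) * (f x + g x)) \<in> F" using scale_mem add_mem fg by blast
      ultimately show ?thesis using fg by (simp add: C_def)
    qed
    show "f \<in> C k" if s: "\<And>n::nat. s n \<in> C k" and f: "f \<in> F"
      and sf: "(\<lambda>n. N (\<lambda>x. s n x - f x)) \<longlonglongrightarrow> 0" for k s f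
    proof -
      interpret s: seminormed_function_space F N by (rule seminormed)
      have sF: "s n \<in> F" for n using s by (simp add: C_def)
      have "N f \<le> R + N (\<lambda>x. s n x - f x)" for n
        using s.norm_diff_le[OF sF s.diff_mem[OF sF f], of n n] s[of n] by (simp add: C_def)
      then have "N f \<le> R"
        using tendsto_lowerbound[of "\<lambda>n. R + N (\<lambda>x. s n x - f x)" R sequentially "N f"]
          tendsto_add[OF tendsto_const sf, of R] by simp
      moreover have "\<bar>L i f\<bar> \<le> 1 / real (Suc k)" if "i \<le> k" for i
        using s that by (intro tendsto_upperbound[OF tendsto_rabs[OF all_info_tendsto[OF L sF f sf]]])
          (auto simp: C_def)
      moreover have "\<delta> \<le> f x"
        using s by (intro tendsto_lowerbound[OF all_info_tendsto[OF eval_in_all_info[OF x] sF f sf]])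
          (auto simp: C_def)
      ultimately show ?thesis using f by (simp add: C_def)
    qed
  qed blast
  then obtain f where f: "\<And>k. f \<in> C k" by blast
  have "L i f = 0" for i
  proof -
    have "\<bar>L i f\<bar> \<le> 1 / real (Suc (n + i))" for n
      using f[of "n + i"] by (simp add: C_def)
    moreover have "(\<lambda>n. 1 / real (Suc (n + i))) \<longlonglongrightarrow> 0"
      using LIMSEQ_ignore_initial_segment[OF LIMSEQ_Suc[OF lim_const_over_n[of "1::real"]], of i] .
    ultimately have "\<bar>L i f\<bar> \<le> 0" by (intro LIMSEQ_le_const[of _ 0]) auto
    then show ?thesis by simp
  qed
  then have "f = (\<lambda>x. 0)" using total f[of 0] by (simp add: C_def)
  then show False using f[of 0] \<open>0 < \<delta>\<close> by (simp add: C_def)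
qed

end

text \<open>Collect, for each \<open>j\<close>, the functionals of an algorithm with error below \<open>1 / (j + 1)\<close>. On their common
kernel the \<open>L\<^sub>\<infinity>\<close> norm vanishes, and only the zero function of \<open>F\<close> vanishes almost everywhere.\<close>

lemma total_info_if_errors_tend_to_zero:
  assumes space: "banach_function_space (space M) F N" and emb: "embedded_in_Lp M \<infinity> F N"
    and lim: "min_error M \<infinity> F N (all_info F N) \<longlonglongrightarrow> 0"
  obtains L :: "nat \<Rightarrow> ('a \<Rightarrow> real) \<Rightarrow> real" where "\<And>i. L i \<in> all_info F N"
    and "\<And>f. f \<in> F \<Longrightarrow> (\<And>i. L i f = 0) \<Longrightarrow> f = (\<lambda>x. 0)"
proof -
  interpret banach_function_space "space M" F N by (rule space)
  have zero: "(\<lambda>f. 0) \<in> all_info F N" by (auto simp: all_info_def intro: exI[of _ 0])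
  have "\<exists>L :: nat \<Rightarrow> ('a \<Rightarrow> real) \<Rightarrow> real. (\<forall>i. L i \<in> all_info F N) \<and>
      (\<forall>f\<in>F. (\<forall>i. L i f = 0) \<longrightarrow> Lp_norm M \<infinity> f \<le> ennreal (1 / real (Suc j) * N f))" for j
  proof -
    have "\<forall>\<^sub>F n in sequentially. min_error M \<infinity> F N (all_info F N) n < ennreal (1 / real (Suc j))"
      using lim by (rule order_tendstoD) simp
    then obtain n where "min_error M \<infinity> F N (all_info F N) n < ennreal (1 / real (Suc j))"
      by (auto simp: eventually_sequentially)
    then obtain A where A: "A \<in> algorithms M \<infinity> (all_info F N) n"
      and err: "wor_error M \<infinity> F N A < ennreal (1 / real (Suc j))"
      by (auto simp: min_error_def INF_less_iff)
    obtain L where L: "\<And>i. i < n \<Longrightarrow> L i \<in> all_info F N"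
      and ker: "\<And>f. f \<in> F \<Longrightarrow> (\<And>i. i < n \<Longrightarrow> L i f = 0) \<Longrightarrow>
        Lp_norm M \<infinity> f \<le> ennreal (1 / real (Suc j) * N f)"
      by (rule Linf_norm_le_on_kernel[OF space emb A less_imp_le[OF err]]) auto
    show ?thesis
    proof (intro exI[of _ "\<lambda>i. if i < n then L i else (\<lambda>f. 0)"] conjI allI ballI impI)
      show "(if i < n then L i else (\<lambda>f. 0)) \<in> all_info F N" for i using L zero by simp
      fix f assume f: "f \<in> F" and "\<forall>i. (if i < n then L i else (\<lambda>f. 0)) f = 0"
      then have "L i f = 0" if "i < n" for i using that by (metis (full_types))
      then show "Lp_norm M \<infinity> f \<le> ennreal (1 / real (Suc j) * N f)" by (rule ker[OF f])
    qed
  qed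
  then obtain L :: "nat \<Rightarrow> nat \<Rightarrow> ('a \<Rightarrow> real) \<Rightarrow> real" where L: "\<And>i j. L j i \<in> all_info F N"
    and ker: "\<And>j f. f \<in> F \<Longrightarrow> (\<forall>i. L j i f = 0) \<Longrightarrow>
      Lp_norm M \<infinity> f \<le> ennreal (1 / real (Suc j) * N f)"
    by metis
  show ?thesis
  proof (rule that[of "\<lambda>i. case prod_decode i of (j, l) \<Rightarrow> L j l"])
    show "(case prod_decode i of (j, l) \<Rightarrow> L j l) \<in> all_info F N" for i
      using L by (simp split: prod.split)
    fix f assume f: "f \<in> F" and "\<And>i. (case prod_decode i of (j, l) \<Rightarrow> L j l) f = 0"
    then have "L j l f = 0" for j l
      by (metis (mono_tags, lifting) case_prod_conv prod_encode_inverse)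
    then have "Lp_norm M \<infinity> f \<le> ennreal (1 / real (Suc j) * N f)" for j using ker f by blast
    then have "AE x in M. \<forall>j. \<bar>f x\<bar> \<le> 1 / real (Suc j) * N f"
      using norm_nonneg[OF f] by (simp add: AE_all_countable Linf_norm_leD)
    then have "AE x in M. f x = 0"
    proof eventually_elim
      case (elim x)
      have "(\<lambda>j. 1 / real (Suc j) * N f) \<longlonglongrightarrow> 0 * N f"
        by (intro tendsto_mult LIMSEQ_Suc[OF lim_const_over_n[of "1::real"]] tendsto_const)
      then have "\<bar>f x\<bar> \<le> 0" using elim by (intro LIMSEQ_le_const[of _ 0]) auto
      then show ?case by simp
    qed
    then show "f = (\<lambda>x. 0)" using emb f zero_mem by (auto simp: embedded_in_Lp_def)
  qed
qed

lemma abs_diff_le_if_floor_eq: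
  fixes a b c :: real
  assumes "\<lfloor>c * a\<rfloor> = \<lfloor>c * b\<rfloor>" and "0 < c"
  shows "\<bar>a - b\<bar> \<le> 1 / c"
proof -
  have "\<bar>c * a - c * b\<bar> \<le> 1"
    using floor_correct[of "c * a"] floor_correct[of "c * b"] assms(1) by linarith
  then have "c * \<bar>a - b\<bar> \<le> 1" using \<open>0 < c\<close> by (simp add: abs_mult flip: right_diff_distrib)
  then show ?thesis using \<open>0 < c\<close> by (simp add: field_simps)
qed

text \<open>For each \<open>k\<close>, the integer key of \<open>f\<close> records its norm, its \<open>L\<^sub>\<infinity>\<close> norm and the first functionals,
the last two up to \<open>1 / (k + 1)\<close>. There are only countably many keys, so choosing one representative
\<open>d k f\<close> for each gives a countable set \<open>D\<close>. The sequence \<open>d k f\<close> converges to \<open>f\<close> at every point, and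
the \<open>L\<^sub>\<infinity>\<close> norms converge as well.\<close>

theorem hilbert_common_null_set:
  assumes space: "hilbert_function_space (space M) F N" and emb: "embedded_in_Lp M \<infinity> F N"
    and lim: "min_error M \<infinity> F N (all_info F N) \<longlonglongrightarrow> 0"
  shows "common_null_set M F"
proof -
  interpret hilbert_function_space "space M" F N by (rule space)
  interpret s: seminormed_function_space F N by (rule seminormed)
  obtain L :: "nat \<Rightarrow> ('a \<Rightarrow> real) \<Rightarrow> real" where L: "\<And>i. L i \<in> all_info F N"
    and total: "\<And>f. f \<in> F \<Longrightarrow> (\<And>i. L i f = 0) \<Longrightarrow> f = (\<lambda>x. 0)"
    using total_info_if_errors_tend_to_zero[OF banach_function_space_axioms emb lim] by blast
  define nrm where "nrm f = enn2real (Lp_norm M \<infinity> f)" for f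
  have nrm: "Lp_norm M \<infinity> f = ennreal (nrm f)" if "f \<in> F" for f
    using emb that by (auto simp: embedded_in_Lp_def Lp_def nrm_def)
  have meas: "f \<in> borel_measurable M" if "f \<in> F" for f
    using emb that by (auto simp: embedded_in_Lp_def Lp_def)
  define key where "key k f = (\<lceil>N f\<rceil>, \<lfloor>real (Suc k) * nrm f\<rfloor>,
    map (\<lambda>i. \<lfloor>real (Suc k) * L i f\<rfloor>) [0..<Suc k])" for k f
  define d where "d k f = inv_into F (key k) (key k f)" for k f
  have dF: "d k f \<in> F" and key_d: "key k (d k f) = key k f" if "f \<in> F" for k f
    using that by (auto simp: d_def inv_into_into f_inv_into_f)
  define D where "D = (\<Union>k. d k ` F)"
  have "d k ` F = inv_into F (key k) ` (key k ` F)" for k by (simp add: d_def image_image)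
  then have "countable D" unfolding D_def by (intro countable_UN) auto
  define bad where "bad g = {x \<in> space M. \<not> ennreal \<bar>g x\<bar> \<le> Lp_norm M \<infinity> g}" for g
  have "(\<Union>g\<in>D. bad g) \<in> null_sets M"
  proof (rule null_sets_UN'[OF \<open>countable D\<close>])
    fix g assume "g \<in> D"
    then have [measurable]: "g \<in> borel_measurable M" using dF meas by (auto simp: D_def)
    have "bad g \<in> sets M" unfolding bad_def by measurable
    then show "bad g \<in> null_sets M"
      using Linf_norm_AE[of g M] by (simp add: AE_iff_null bad_def)
  qed
  moreover have "ennreal \<bar>f x\<bar> \<le> Lp_norm M \<infinity> f"
    if f: "f \<in> F" and x: "x \<in> space M - (\<Union>g\<in>D. bad g)" for f x
  proof -
    have d_le: "\<bar>d k f x\<bar> \<le> nrm f + 1 / real (Suc k)" for k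
    proof -
      have "d k f \<in> D" using f by (auto simp: D_def)
      then have "ennreal \<bar>d k f x\<bar> \<le> ennreal (nrm (d k f))"
        using x nrm[OF dF[OF f]] by (auto simp: bad_def)
      then have "\<bar>d k f x\<bar> \<le> nrm (d k f)" by (simp add: nrm_def)
      moreover have "\<bar>nrm (d k f) - nrm f\<bar> \<le> 1 / real (Suc k)"
        using key_d[OF f, of k] by (intro abs_diff_le_if_floor_eq) (auto simp: key_def)
      ultimately show ?thesis by linarith
    qed
    have "(\<lambda>k. f x - d k f x) \<longlonglongrightarrow> 0"
    proof (rule eval_tendsto_zero[of L "\<lambda>k x. f x - d k f x" "N f + \<lceil>N f\<rceil>" x, OF L total])
      show "(\<lambda>x. f x - d k f x) \<in> F" for k using f dF by (intro s.diff_mem) auto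
      show "N (\<lambda>x. f x - d k f x) \<le> N f + \<lceil>N f\<rceil>" for k
      proof -
        have "\<lceil>N (d k f)\<rceil> = \<lceil>N f\<rceil>" using key_d[OF f, of k] by (simp add: key_def)
        then have "N (d k f) \<le> \<lceil>N f\<rceil>" by linarith
        then show ?thesis using s.norm_diff_le[OF f dF[OF f], of k] by linarith
      qed
      show "x \<in> space M" using x by blast
      show "(\<lambda>k. L i (\<lambda>x. f x - d k f x)) \<longlonglongrightarrow> 0" for i
      proof (rule Lim_null_comparison)
        show "(\<lambda>k. 1 / real (Suc k)) \<longlonglongrightarrow> 0"
          using LIMSEQ_Suc[OF lim_const_over_n[of "1::real"]] .
        have "\<bar>L i (\<lambda>x. f x - d k f x)\<bar> \<le> 1 / real (Suc k)" if "i \<le> k" for k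
        proof -
          have "map (\<lambda>i. \<lfloor>real (Suc k) * L i f\<rfloor>) [0..<Suc k] ! i
              = map (\<lambda>i. \<lfloor>real (Suc k) * L i (d k f)\<rfloor>) [0..<Suc k] ! i"
            using key_d[OF f, of k] by (simp only: key_def prod.inject)
          then have "\<lfloor>real (Suc k) * L i f\<rfloor> = \<lfloor>real (Suc k) * L i (d k f)\<rfloor>"
            using that by (simp del: upt_Suc add: nth_append)
          then have "\<bar>L i f - L i (d k f)\<bar> \<le> 1 / real (Suc k)"
            by (intro abs_diff_le_if_floor_eq) auto
          moreover have "linear_form F (L i)" using L by (simp add: all_info_iff)
          ultimately show ?thesis using s.linear_form_diff f dF[OF f] by simp
        qed
        then show "\<forall>\<^sub>F k in sequentially. norm (L i (\<lambda>x. f x - d k f x)) \<le> 1 / real (Suc k)"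
          by (intro eventually_mono[OF eventually_ge_at_top[of i]]) simp
      qed
    qed
    then have "(\<lambda>k. \<bar>f x - (f x - d k f x)\<bar>) \<longlonglongrightarrow> \<bar>f x - 0\<bar>" by (intro tendsto_intros)
    moreover have "(\<lambda>k. nrm f + 1 / real (Suc k)) \<longlonglongrightarrow> nrm f + 0"
      by (intro tendsto_intros LIMSEQ_Suc[OF lim_const_over_n[of "1::real"]])
    ultimately have "\<bar>f x - 0\<bar> \<le> nrm f + 0"
      by (rule LIMSEQ_le) (use d_le in auto)
    then show ?thesis using nrm[OF f] by (simp add: ennreal_leI)
  qed
  ultimately show ?thesis unfolding common_null_set_def by blast
qed

section \<open>Rates of convergence\<close>

lemma rate_antimono:
  assumes "\<And>n. c n \<le> d n"
  shows "rate d \<le> rate c"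
proof (cases "d \<longlonglongrightarrow> 0")
  case True
  have "c \<longlonglongrightarrow> 0"
    by (rule tendsto_sandwich[OF _ _ tendsto_const True]) (use assms in auto)
  moreover have "(\<lambda>n. c n * ennreal (real n powr \<beta>)) \<longlonglongrightarrow> 0"
    if "(\<lambda>n. d n * ennreal (real n powr \<beta>)) \<longlonglongrightarrow> 0" for \<beta>
    by (rule tendsto_sandwich[OF _ _ tendsto_const that]) (simp_all add: assms mult_right_mono)
  ultimately show ?thesis
    using True by (auto simp: rate_def intro!: SUP_subset_mono)
qed (simp add: rate_def)

lemma tendsto_zero_if_eventually_le:
  fixes c d :: "nat \<Rightarrow> ennreal"
  assumes "\<forall>\<^sub>F n in sequentially. c n \<le> d n" and "d \<longlonglongrightarrow> 0"
  shows "c \<longlonglongrightarrow> 0"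
  by (rule tendsto_sandwich[OF _ assms(1) tendsto_const assms(2)]) simp

lemma exponents_below_rate:
  assumes "ennreal t < rate c" and "0 \<le> t"
  obtains \<beta> where "t < \<beta>" and "(\<lambda>n. c n * ennreal (real n powr \<beta>)) \<longlonglongrightarrow> 0"
  using assms by (auto simp: rate_def less_SUP_iff ennreal_less_iff split: if_splits)

lemma rate_loss_one:
  assumes rate: "rate c = ennreal r" and "1 < r"
    and le: "\<And>n. d n \<le> ennreal (4 * real n + 2) * c n"
  shows "ennreal (r - 1) \<le> rate d"
proof -
  have d_lim: "(\<lambda>n. d n * ennreal (real n powr (\<beta> - 1))) \<longlonglongrightarrow> 0"
    if c_lim: "(\<lambda>n. c n * ennreal (real n powr \<beta>)) \<longlonglongrightarrow> 0" for \<beta>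
  proof (rule tendsto_zero_if_eventually_le)
    have "(\<lambda>n. ennreal 6 * (c n * ennreal (real n powr \<beta>))) \<longlonglongrightarrow> ennreal 6 * 0"
      by (intro ennreal_tendsto_cmult c_lim) simp
    then show "(\<lambda>n. ennreal 6 * (c n * ennreal (real n powr \<beta>))) \<longlonglongrightarrow> 0" by simp
    have "d n * ennreal (real n powr (\<beta> - 1)) \<le> ennreal 6 * (c n * ennreal (real n powr \<beta>))"
      if "1 \<le> n" for n
    proof -
      \<comment> \<open>As \<open>4 n + 2 \<le> 6 n\<close>, one power of \<open>n\<close> pays for the factor.\<close>
      have "(4 * real n + 2) * real n powr (\<beta> - 1) \<le> 6 * real n * real n powr (\<beta> - 1)"
        using that by (intro mult_right_mono) auto
      also have "\<dots> = 6 * real n powr \<beta>"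
        using that by (simp add: powr_diff)
      finally have "ennreal ((4 * real n + 2) * real n powr (\<beta> - 1)) \<le> ennreal (6 * real n powr \<beta>)"
        by (rule ennreal_leI)
      then have *: "ennreal (4 * real n + 2) * ennreal (real n powr (\<beta> - 1))
          \<le> ennreal 6 * ennreal (real n powr \<beta>)"
        by (subst (1 2) ennreal_mult[symmetric]) simp_all
      have "d n * ennreal (real n powr (\<beta> - 1))
          \<le> ennreal (4 * real n + 2) * c n * ennreal (real n powr (\<beta> - 1))"
        by (rule mult_right_mono[OF le]) simp
      also have "\<dots> = c n * (ennreal (4 * real n + 2) * ennreal (real n powr (\<beta> - 1)))"
        by (simp only: mult_ac)
      also have "\<dots> \<le> c n * (ennreal 6 * ennreal (real n powr \<beta>))"
        by (rule mult_left_mono[OF *]) simp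
      also have "\<dots> = ennreal 6 * (c n * ennreal (real n powr \<beta>))"
        by (simp only: mult_ac)
      finally show ?thesis .
    qed
    then show "\<forall>\<^sub>F n in sequentially. d n * ennreal (real n powr (\<beta> - 1))
        \<le> ennreal 6 * (c n * ennreal (real n powr \<beta>))"
      by (rule eventually_sequentiallyI)
  qed
  have exp_le: "ennreal (\<beta> - 1) \<le> rate d"
    if "1 < \<beta>" and c_lim: "(\<lambda>n. c n * ennreal (real n powr \<beta>)) \<longlonglongrightarrow> 0" for \<beta>
  proof -
    have "d n \<le> d n * ennreal (real n powr (\<beta> - 1))" if "1 \<le> n" for n
    proof -
      have "ennreal 1 \<le> ennreal (real n powr (\<beta> - 1))"
        using that \<open>1 < \<beta>\<close> by (intro ennreal_leI ge_one_powr_ge_zero) auto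
      then have "d n * 1 \<le> d n * ennreal (real n powr (\<beta> - 1))" by (intro mult_left_mono) auto
      then show ?thesis by simp
    qed
    then have "d \<longlonglongrightarrow> 0"
      by (intro tendsto_zero_if_eventually_le[OF _ d_lim[OF c_lim]] eventually_sequentiallyI)
    then show ?thesis
      using d_lim[OF c_lim] \<open>1 < \<beta>\<close> by (auto simp: rate_def intro!: SUP_upper)
  qed
  show ?thesis
  proof (rule dense_le_bounded[of 0])
    show "0 < ennreal (r - 1)" using \<open>1 < r\<close> by simp
    fix w assume w: "0 < w" "w < ennreal (r - 1)"
    then obtain q where q: "w = ennreal q" "0 < q" "q < r - 1"
      by (cases w) (auto simp: ennreal_less_iff)
    then have "ennreal (q + 1) < rate c" unfolding rate by (subst ennreal_less_iff) auto
    then obtain \<beta> where "q + 1 < \<beta>" "(\<lambda>n. c n * ennreal (real n powr \<beta>)) \<longlonglongrightarrow> 0"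
      using exponents_below_rate[of "q + 1" c] q by auto
    then have "ennreal (\<beta> - 1) \<le> rate d" using q by (intro exp_le) auto
    moreover have "w \<le> ennreal (\<beta> - 1)" using \<open>q + 1 < \<beta>\<close> q by (simp add: ennreal_leI)
    ultimately show "w \<le> rate d" by simp
  qed
qed

lemma rate_eqI:
  assumes "0 < r" and "0 < b"
    and lower: "\<And>n. 1 \<le> n \<Longrightarrow> ennreal (b * real n powr - r) \<le> c n"
    and upper: "\<And>n. 1 \<le> n \<Longrightarrow> c n \<le> ennreal (a * real n powr - r)"
  shows "rate c = ennreal r"
proof -
  have lim: "(\<lambda>n. c n * ennreal (real n powr \<beta>)) \<longlonglongrightarrow> 0" if "\<beta> < r" for \<beta>
  proof (rule tendsto_zero_if_eventually_le)
    have "(\<lambda>n. real n powr (\<beta> - r)) \<longlonglongrightarrow> 0"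
      using that by (intro tendsto_neg_powr filterlim_real_sequentially) simp
    then have "(\<lambda>n. a * real n powr (\<beta> - r)) \<longlonglongrightarrow> a * 0" by (rule tendsto_mult_left)
    then show "(\<lambda>n. ennreal (a * real n powr (\<beta> - r))) \<longlonglongrightarrow> 0"
      using tendsto_ennrealI by fastforce
    have "c n * ennreal (real n powr \<beta>) \<le> ennreal (a * real n powr (\<beta> - r))" if "1 \<le> n" for n
    proof -
      have "c n * ennreal (real n powr \<beta>) \<le> ennreal (a * real n powr - r) * ennreal (real n powr \<beta>)"
        by (rule mult_right_mono[OF upper[OF that]]) simp
      also have "\<dots> = ennreal (a * real n powr - r * real n powr \<beta>)"
        by (rule ennreal_mult''[symmetric]) simp
      also have "a * real n powr - r * real n powr \<beta> = a * real n powr (\<beta> - r)"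
        by (simp add: powr_add[symmetric] algebra_simps)
      finally show ?thesis .
    qed
    then show "\<forall>\<^sub>F n in sequentially. c n * ennreal (real n powr \<beta>) \<le> ennreal (a * real n powr (\<beta> - r))"
      by (rule eventually_sequentiallyI)
  qed
  have "c \<longlonglongrightarrow> 0"
  proof (rule tendsto_zero_if_eventually_le[OF _ lim[OF \<open>0 < r\<close>]])
    show "\<forall>\<^sub>F n in sequentially. c n \<le> c n * ennreal (real n powr 0)"
      by (rule eventually_sequentiallyI[of 1]) simp
  qed
  then have rate: "rate c =
      (SUP \<beta>\<in>{\<beta>. 0 \<le> \<beta> \<and> (\<lambda>n. c n * ennreal (real n powr \<beta>)) \<longlonglongrightarrow> 0}. ennreal \<beta>)"
    by (simp add: rate_def)
  show ?thesis
  proof (rule antisym)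
    show "rate c \<le> ennreal r"
      unfolding rate
    proof (rule SUP_least)
      fix \<beta> assume "\<beta> \<in> {\<beta>. 0 \<le> \<beta> \<and> (\<lambda>n. c n * ennreal (real n powr \<beta>)) \<longlonglongrightarrow> 0}"
      then have lim\<beta>: "(\<lambda>n. c n * ennreal (real n powr \<beta>)) \<longlonglongrightarrow> 0" by simp
      have "\<beta> \<le> r"
      proof (rule ccontr)
        assume "\<not> \<beta> \<le> r"
        have "ennreal b \<le> c n * ennreal (real n powr \<beta>)" if "1 \<le> n" for n
        proof -
          have "1 \<le> real n powr (\<beta> - r)"
            using that \<open>\<not> \<beta> \<le> r\<close> by (intro ge_one_powr_ge_zero) auto
          then have "b * 1 \<le> b * real n powr (\<beta> - r)"
            using \<open>0 < b\<close> by (intro mult_left_mono) auto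
          also have "\<dots> = b * real n powr - r * real n powr \<beta>"
            by (simp add: powr_add[symmetric] algebra_simps)
          finally have "ennreal b \<le> ennreal (b * real n powr - r * real n powr \<beta>)"
            by (intro ennreal_leI) simp
          also have "\<dots> = ennreal (b * real n powr - r) * ennreal (real n powr \<beta>)"
            by (rule ennreal_mult'') simp
          also have "\<dots> \<le> c n * ennreal (real n powr \<beta>)"
            by (rule mult_right_mono[OF lower[OF that]]) simp
          finally show ?thesis .
        qed
        then have "ennreal b \<le> 0" by (intro LIMSEQ_le_const[OF lim\<beta>] exI[of _ 1]) auto
        then show False using \<open>0 < b\<close> by simp
      qed
      then show "ennreal \<beta> \<le> ennreal r" by (rule ennreal_leI)
    qed
    show "ennreal r \<le> rate c"
    proof (rule dense_le_bounded[of 0])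
      show "0 < ennreal r" using \<open>0 < r\<close> by simp
      fix t assume t: "0 < t" "t < ennreal r"
      then obtain \<beta> where "t = ennreal \<beta>" "0 < \<beta>" "\<beta> < r"
        by (cases t) (auto simp: ennreal_less_iff)
      then show "t \<le> rate c" unfolding rate using lim by (auto intro!: SUP_upper)
    qed
  qed
qed

lemma errors_tend_to_zero_if_rate_pos: "0 < rate c \<Longrightarrow> c \<longlonglongrightarrow> 0"
  by (auto simp: rate_def split: if_splits)

lemma all_error_le_std_error:
  assumes "banach_function_space (space M) F N"
  shows "min_error M p F N (all_info F N) n \<le> min_error M p F N (std_info (space M)) n"
proof -
  interpret banach_function_space "space M" F N by fact
  have "algorithms M p (std_info (space M)) n \<subseteq> algorithms M p (all_info F N) n"
    unfolding algorithms_def using eval_continuous by blast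
  then show ?thesis unfolding min_error_def by (rule INF_superset_mono) simp
qed

lemma rate_std_le_rate_all:
  assumes "banach_function_space (space M) F N"
  shows "rate_std M p F N \<le> rate_all M p F N"
  unfolding rate_std_def rate_all_def by (intro rate_antimono all_error_le_std_error assms)

text \<open>This excludes the empty domain, on which function values are useless, from spaces with a finite rate.\<close>

lemma rate_all_empty_domain:
  assumes space: "banach_function_space (space M) F N" and "space M = {}"
  shows "rate_all M \<infinity> F N = \<infinity>"
proof -
  interpret banach_function_space "space M" F N by (rule space)
  have "Lp_norm M \<infinity> g = 0" for g
  proof -
    have "g \<in> borel_measurable M" using \<open>space M = {}\<close> by (simp add: measurable_def)
    moreover have "AE x in M. ennreal \<bar>g x\<bar> \<le> 0"
      using \<open>space M = {}\<close> by (intro AE_I2) simp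
    ultimately show ?thesis using Linf_norm_leI[of g M 0] by simp
  qed
  then have err: "wor_error M \<infinity> F N A = 0" for A
    using SUP_least[of "{f \<in> F. N f \<le> 1}" "\<lambda>f. Lp_norm M \<infinity> (\<lambda>x. f x - A f x)" 0]
    by (simp add: wor_error_def)
  have zero: "(\<lambda>f. 0) \<in> all_info F N" by (auto simp: all_info_def intro: exI[of _ 0])
  have "min_error M \<infinity> F N (all_info F N) n = 0" for n
  proof -
    have "(\<lambda>f x. 0) \<in> algorithms M \<infinity> (all_info F N) n"
      unfolding algorithms_def using zero \<open>\<And>g. Lp_norm M \<infinity> g = 0\<close>
      by (auto simp: Lp_def intro!: exI[of _ "\<lambda>ys f. 0"] exI[of _ "\<lambda>ys x. 0"])
    then have "min_error M \<infinity> F N (all_info F N) n \<le> wor_error M \<infinity> F N (\<lambda>f x. 0)"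
      unfolding min_error_def by (rule INF_lower)
    then show ?thesis unfolding err by simp
  qed
  then have "min_error M \<infinity> F N (all_info F N) = (\<lambda>n. 0)" by (rule ext)
  then have "rate_all M \<infinity> F N = (SUP \<beta>\<in>{\<beta>::real. 0 \<le> \<beta>}. ennreal \<beta>)"
    unfolding rate_all_def rate_def by (simp only:) simp
  also have "\<dots> = \<infinity>"
  proof (rule ccontr)
    assume "(SUP \<beta>\<in>{\<beta>::real. 0 \<le> \<beta>}. ennreal \<beta>) \<noteq> \<infinity>"
    then obtain b where b: "0 \<le> b" "(SUP \<beta>\<in>{\<beta>::real. 0 \<le> \<beta>}. ennreal \<beta>) = ennreal b"
      by (cases "(SUP \<beta>\<in>{\<beta>::real. 0 \<le> \<beta>}. ennreal \<beta>)") auto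
    have "ennreal (b + 1) \<le> (SUP \<beta>\<in>{\<beta>::real. 0 \<le> \<beta>}. ennreal \<beta>)"
      using b(1) by (intro SUP_upper) simp
    then show False using b by simp
  qed
  finally show ?thesis .
qed

theorem rate_std_ge:
  assumes space: "banach_function_space (space M) F N" and emb: "embedded_in_Lp M \<infinity> F N"
    and common: "common_null_set M F" and rate: "rate_all M \<infinity> F N = ennreal r" and "1 < r"
  shows "ennreal (r - 1) \<le> rate_std M \<infinity> F N"
proof -
  have "space M \<noteq> {}" using rate_all_empty_domain[OF space] rate by auto
  then show ?thesis
    unfolding rate_std_def
    using rate std_error_le_all_error[OF space emb common] \<open>1 < r\<close>
    by (intro rate_loss_one[of "min_error M \<infinity> F N (all_info F N)"]) (auto simp: rate_all_def)
qed

section \<open>Diagonal Hilbert spaces with a prescribed rate\<close>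

lemma orthonormal_in_kernel:
  fixes l :: "nat \<Rightarrow> nat \<Rightarrow> real"
  assumes "n + q \<le> m"
  shows "\<exists>v :: nat \<Rightarrow> nat \<Rightarrow> real.
    (\<forall>p<q. \<forall>p'<q. (\<Sum>i<m. v p i * v p' i) = of_bool (p = p')) \<and>
    (\<forall>p<q. \<forall>j<n. (\<Sum>i<m. l j i * v p i) = 0)"
  using assms
proof (induction q)
  case 0
  then show ?case by simp
next
  case (Suc q)
  then have "n + q \<le> m" by simp
  then obtain v :: "nat \<Rightarrow> nat \<Rightarrow> real" where
    "\<forall>p<q. \<forall>p'<q. (\<Sum>i<m. v p i * v p' i) = of_bool (p = p')"
    "\<forall>p<q. \<forall>j<n. (\<Sum>i<m. l j i * v p i) = 0"
    using Suc.IH by blast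
  then have on: "\<And>p p'. p < q \<Longrightarrow> p' < q \<Longrightarrow> (\<Sum>i<m. v p i * v p' i) = of_bool (p = p')"
    and ker: "\<And>p j. p < q \<Longrightarrow> j < n \<Longrightarrow> (\<Sum>i<m. l j i * v p i) = 0"
    by simp_all
  define c where "c j = (if j < n then l j else v (j - n))" for j
  obtain u where nz: "\<exists>i<m. u i \<noteq> 0" and u: "\<And>j. j < n + q \<Longrightarrow> (\<Sum>i<m. c j i * u i) = 0"
    using nontrivial_solution[of "n + q" m c] Suc.prems by auto
  define s where "s = (\<Sum>i<m. (u i)\<^sup>2)"
  have "0 < s" unfolding s_def using nz by (auto intro!: sum_pos2)
  define w where "w i = u i / sqrt s" for i
  have "(\<Sum>i<m. w i * w i) = 1"
    using \<open>0 < s\<close> by (simp add: w_def s_def power2_eq_square flip: sum_divide_distrib)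
  moreover have "(\<Sum>i<m. v p i * w i) = 0" if "p < q" for p
    using u[of "n + p"] that by (simp add: c_def w_def flip: sum_divide_distrib)
  moreover have "(\<Sum>i<m. l j i * w i) = 0" if "j < n" for j
    using u[of j] that by (simp add: c_def w_def flip: sum_divide_distrib)
  ultimately show ?case
    using on ker
    by (intro exI[of _ "v(q := w)"]) (auto simp: less_Suc_eq mult.commute)
qed

text \<open>For orthonormal vectors \<open>v p\<close> in the kernel, \<open>t i\<close> is the \<open>i\<close>-th diagonal entry of the orthogonal
projection onto their span. The trace is \<open>q\<close>, so some \<open>t i\<close> is at least \<open>q / m\<close>. The normalized projection
of the \<open>i\<close>-th unit vector has \<open>i\<close>-th coordinate \<open>sqrt (t i)\<close>.\<close>

lemma kernel_has_large_coordinate: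
  fixes l :: "nat \<Rightarrow> nat \<Rightarrow> real"
  assumes "n + q \<le> m" and "0 < q"
  obtains a i where "i < m" and "(\<Sum>i<m. (a i)\<^sup>2) = 1"
    and "\<And>j. j < n \<Longrightarrow> (\<Sum>i<m. l j i * a i) = 0" and "real q / real m \<le> (a i)\<^sup>2"
proof -
  obtain v :: "nat \<Rightarrow> nat \<Rightarrow> real" where
    on: "\<And>p p'. p < q \<Longrightarrow> p' < q \<Longrightarrow> (\<Sum>i<m. v p i * v p' i) = of_bool (p = p')"
    and ker: "\<And>p j. p < q \<Longrightarrow> j < n \<Longrightarrow> (\<Sum>i<m. l j i * v p i) = 0"
    using orthonormal_in_kernel[OF assms(1), of l] by blast
  define t where "t i = (\<Sum>p<q. (v p i)\<^sup>2)" for i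
  have "(\<Sum>i<m. t i) = (\<Sum>p<q. \<Sum>i<m. v p i * v p i)"
    unfolding t_def by (subst sum.swap) (simp add: power2_eq_square)
  also have "\<dots> = real q" using on by simp
  finally have sum_t: "(\<Sum>i<m. t i) = real q" .
  have "\<exists>i<m. real q / real m \<le> t i"
  proof (rule ccontr)
    assume "\<not> ?thesis"
    then have "(\<Sum>i<m. t i) < (\<Sum>i<m. real q / real m)"
      using assms by (intro sum_strict_mono) (auto simp: lessThan_empty_iff)
    then show False using sum_t assms by simp
  qed
  then obtain i where i: "i < m" "real q / real m \<le> t i" by blast
  moreover have "0 < real q / real m" using assms by simp
  ultimately have "0 < t i" by linarith
  define a where "a k = (\<Sum>p<q. v p i * v p k) / sqrt (t i)" for k
  show ?thesis
  proof (rule that[of i a])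
    show "i < m" by fact
    have "(\<Sum>k<m. (\<Sum>p<q. v p i * v p k)\<^sup>2)
        = (\<Sum>k<m. \<Sum>p<q. \<Sum>p'<q. v p i * v p' i * (v p k * v p' k))"
      unfolding power2_eq_square sum_product by (intro sum.cong refl) (simp add: mult_ac)
    also have "\<dots> = (\<Sum>p<q. \<Sum>k<m. \<Sum>p'<q. v p i * v p' i * (v p k * v p' k))"
      by (rule sum.swap)
    also have "\<dots> = (\<Sum>p<q. \<Sum>p'<q. \<Sum>k<m. v p i * v p' i * (v p k * v p' k))"
      by (rule sum.cong[OF refl]) (rule sum.swap)
    also have "\<dots> = (\<Sum>p<q. \<Sum>p'<q. v p i * v p' i * (\<Sum>k<m. v p k * v p' k))"
      by (simp only: sum_distrib_left)
    also have "\<dots> = (\<Sum>p<q. \<Sum>p'<q. if p = p' then v p i * v p' i else 0)"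
      using on by (intro sum.cong) auto
    also have "\<dots> = t i" by (simp add: t_def power2_eq_square)
    finally show "(\<Sum>k<m. (a k)\<^sup>2) = 1"
      using \<open>0 < t i\<close> by (simp add: a_def power_divide flip: sum_divide_distrib)
    show "(\<Sum>k<m. l j k * a k) = 0" if "j < n" for j
    proof -
      have "(\<Sum>k<m. l j k * (\<Sum>p<q. v p i * v p k)) = (\<Sum>k<m. \<Sum>p<q. v p i * (l j k * v p k))"
        by (simp add: sum_distrib_left mult_ac)
      also have "\<dots> = (\<Sum>p<q. v p i * (\<Sum>k<m. l j k * v p k))"
        by (subst sum.swap) (simp add: sum_distrib_left)
      also have "\<dots> = 0" using ker that by simp
      finally show ?thesis by (simp add: a_def flip: sum_divide_distrib)
    qed
    have "a i = t i / sqrt (t i)" by (simp add: a_def t_def power2_eq_square)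
    then show "real q / real m \<le> (a i)\<^sup>2"
      using i \<open>0 < t i\<close> by (simp add: power_divide power2_eq_square)
  qed
qed

text \<open>The image of the space of square summable sequences under division by the weights, placed on the points
\<open>\<iota> i\<close>. Weights of at least 1 make point evaluations contractive.\<close>

locale weighted_l2 =
  fixes \<iota> :: "nat \<Rightarrow> 'a" and w :: "nat \<Rightarrow> real"
  assumes inj: "inj \<iota>" and w_ge_1: "\<And>i. 1 \<le> w i"
begin

definition F :: "('a \<Rightarrow> real) set" where
  "F = {f. (\<forall>x. x \<notin> range \<iota> \<longrightarrow> f x = 0) \<and> summable (\<lambda>i. (w i * f (\<iota> i))\<^sup>2)}"

definition N :: "('a \<Rightarrow> real) \<Rightarrow> real" where
  "N f = sqrt (\<Sum>i. (w i * f (\<iota> i))\<^sup>2)"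

text \<open>Finite sections reduce the norm to \<^const>\<open>L2_set\<close>, which supplies the triangle inequality and passes to
pointwise limits.\<close>

lemma memI_norm_le:
  assumes "\<And>x. x \<notin> range \<iota> \<Longrightarrow> f x = 0" and "0 \<le> c"
    and le: "\<And>m. L2_set (\<lambda>i. w i * f (\<iota> i)) {..<m} \<le> c"
  shows "f \<in> F" and "N f \<le> c"
proof -
  have sq: "(\<Sum>i<m. (w i * f (\<iota> i))\<^sup>2) \<le> c\<^sup>2" for m
    using power_mono[OF le[of m], of 2] by (simp add: L2_set_def sum_nonneg)
  have "summable (\<lambda>i. (w i * f (\<iota> i))\<^sup>2)"
    by (rule summableI_nonneg_bounded[OF _ sq]) simp
  then show "f \<in> F" using assms(1) by (simp add: F_def)
  have "(\<Sum>i. (w i * f (\<iota> i))\<^sup>2) \<le> c\<^sup>2"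
    using \<open>summable _\<close> sq by (rule suminf_le_const)
  then show "N f \<le> c" unfolding N_def using \<open>0 \<le> c\<close> by (intro real_le_lsqrt) (auto intro: suminf_nonneg \<open>summable _\<close>)
qed

lemma L2_set_le_norm: "f \<in> F \<Longrightarrow> L2_set (\<lambda>i. w i * f (\<iota> i)) {..<m} \<le> N f"
  unfolding L2_set_def N_def F_def by (intro real_sqrt_le_mono sum_le_suminf) auto

lemma weighted_value_le: "f \<in> F \<Longrightarrow> w i * \<bar>f (\<iota> i)\<bar> \<le> N f"
proof -
  assume f: "f \<in> F"
  have "\<bar>w i * f (\<iota> i)\<bar> \<le> L2_set (\<lambda>i. w i * f (\<iota> i)) {..<Suc i}"
    using member_le_L2_set[of "{..<Suc i}" i "\<lambda>i. \<bar>w i * f (\<iota> i)\<bar>"] by (simp add: L2_set_def)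
  also have "\<dots> \<le> N f" by (rule L2_set_le_norm[OF f])
  finally show ?thesis using w_ge_1[of i] by (simp add: abs_mult)
qed

lemma value_le: "f \<in> F \<Longrightarrow> \<bar>f (\<iota> i)\<bar> \<le> N f"
  using weighted_value_le[of f i] mult_right_mono[OF w_ge_1[of i], of "\<bar>f (\<iota> i)\<bar>"] by simp

lemma N_nonneg: "f \<in> F \<Longrightarrow> 0 \<le> N f"
  unfolding N_def F_def by (auto intro: suminf_nonneg)

lemma zero_outside: "f \<in> F \<Longrightarrow> x \<notin> range \<iota> \<Longrightarrow> f x = 0"
  by (simp add: F_def)

lemma add_closed:
  assumes f: "f \<in> F" and g: "g \<in> F"
  shows "(\<lambda>x. f x + g x) \<in> F" and "N (\<lambda>x. f x + g x) \<le> N f + N g"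
proof -
  have "L2_set (\<lambda>i. w i * (f (\<iota> i) + g (\<iota> i))) {..<m} \<le> N f + N g" for m
  proof -
    have "L2_set (\<lambda>i. w i * (f (\<iota> i) + g (\<iota> i))) {..<m}
        \<le> L2_set (\<lambda>i. w i * f (\<iota> i)) {..<m} + L2_set (\<lambda>i. w i * g (\<iota> i)) {..<m}"
      using L2_set_triangle_ineq[of "\<lambda>i. w i * f (\<iota> i)" "\<lambda>i. w i * g (\<iota> i)" "{..<m}"]
      by (simp add: distrib_left)
    then show ?thesis using L2_set_le_norm[OF f, of m] L2_set_le_norm[OF g, of m] by linarith
  qed
  moreover have "f x + g x = 0" if "x \<notin> range \<iota>" for x using zero_outside[OF f that] zero_outside[OF g that] by simp
  moreover have "0 \<le> N f + N g" using N_nonneg f g by simp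
  ultimately show "(\<lambda>x. f x + g x) \<in> F" and "N (\<lambda>x. f x + g x) \<le> N f + N g"
    using memI_norm_le[of "\<lambda>x. f x + g x" "N f + N g"] by blast+
qed

lemma scale_closed:
  assumes f: "f \<in> F"
  shows "(\<lambda>x. c * f x) \<in> F" and "N (\<lambda>x. c * f x) = \<bar>c\<bar> * N f"
proof -
  have eq: "(\<lambda>i. (w i * (c * f (\<iota> i)))\<^sup>2) = (\<lambda>i. c\<^sup>2 * (w i * f (\<iota> i))\<^sup>2)"
    by (simp add: power_mult_distrib mult_ac)
  show "(\<lambda>x. c * f x) \<in> F"
    using f unfolding F_def by (simp add: eq summable_mult)
  show "N (\<lambda>x. c * f x) = \<bar>c\<bar> * N f"
    using f unfolding N_def eq F_def by (simp add: suminf_mult real_sqrt_mult)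
qed

lemma norm_zero_iff: "f \<in> F \<Longrightarrow> N f = 0 \<longleftrightarrow> f = (\<lambda>x. 0)"
proof
  assume f: "f \<in> F" and "N f = 0"
  then have "f (\<iota> i) = 0" for i using value_le[OF f, of i] by simp
  then show "f = (\<lambda>x. 0)" using zero_outside[OF f] by (metis imageE ext)
qed (simp add: N_def)

lemma norm_complete:
  fixes s :: "nat \<Rightarrow> 'a \<Rightarrow> real"
  assumes s: "\<And>n. s n \<in> F"
    and cauchy: "\<And>e. 0 < e \<Longrightarrow> \<exists>K. \<forall>m\<ge>K. \<forall>n\<ge>K. N (\<lambda>x. s m x - s n x) < e"
  shows "\<exists>f\<in>F. (\<lambda>n. N (\<lambda>x. s n x - f x)) \<longlonglongrightarrow> 0"
proof -
  have diff: "(\<lambda>x. f x - g x) \<in> F" if "f \<in> F" "g \<in> F" for f g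
    using add_closed(1)[OF that(1) scale_closed(1)[OF that(2), of "- 1"]] by simp
  have "Cauchy (\<lambda>n. s n (\<iota> i))" for i
  proof (rule metric_CauchyI)
    fix e :: real assume "0 < e"
    then obtain K where K: "\<forall>m\<ge>K. \<forall>n\<ge>K. N (\<lambda>x. s m x - s n x) < e" using cauchy by blast
    have "dist (s m (\<iota> i)) (s n (\<iota> i)) < e" if "K \<le> m" "K \<le> n" for m n
    proof -
      have "N (\<lambda>x. s m x - s n x) < e" using K that by blast
      then show ?thesis
        using value_le[OF diff[OF s[of m] s[of n]], of i] by (simp add: dist_real_def)
    qed
    then show "\<exists>K. \<forall>m\<ge>K. \<forall>n\<ge>K. dist (s m (\<iota> i)) (s n (\<iota> i)) < e" by blast
  qed
  then have "convergent (\<lambda>n. s n (\<iota> i))" for i by (rule Cauchy_convergent)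
  then have "\<forall>i. \<exists>l. (\<lambda>n. s n (\<iota> i)) \<longlonglongrightarrow> l" by (simp add: convergent_def)
  from choice[OF this] obtain l where l: "\<And>i. (\<lambda>n. s n (\<iota> i)) \<longlonglongrightarrow> l i" by blast
  define f where "f x = (if x \<in> range \<iota> then l (inv_into UNIV \<iota> x) else 0)" for x
  have f_val: "f (\<iota> i) = l i" for i by (simp add: f_def inv_f_f[OF inj])
  have close: "(\<lambda>x. f x - s n x) \<in> F \<and> N (\<lambda>x. f x - s n x) \<le> e"
    if "0 \<le> e" and K: "\<forall>m\<ge>K. \<forall>n\<ge>K. N (\<lambda>x. s m x - s n x) < e" and "K \<le> n" for e K n
  proof -
    have "L2_set (\<lambda>i. w i * (f (\<iota> i) - s n (\<iota> i))) {..<k} \<le> e" for k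
    proof (rule tendsto_upperbound)
      show "(\<lambda>m. L2_set (\<lambda>i. w i * (s m (\<iota> i) - s n (\<iota> i))) {..<k})
          \<longlonglongrightarrow> L2_set (\<lambda>i. w i * (f (\<iota> i) - s n (\<iota> i))) {..<k}"
        unfolding L2_set_def f_val by (intro tendsto_intros l)
      have "L2_set (\<lambda>i. w i * (s m (\<iota> i) - s n (\<iota> i))) {..<k} \<le> e" if "K \<le> m" for m
        using L2_set_le_norm[OF diff[OF s[of m] s[of n]], of k] K that \<open>K \<le> n\<close> by fastforce
      then show "\<forall>\<^sub>F m in sequentially. L2_set (\<lambda>i. w i * (s m (\<iota> i) - s n (\<iota> i))) {..<k} \<le> e"
        by (rule eventually_sequentiallyI)
    qed simp
    moreover have "f x - s n x = 0" if "x \<notin> range \<iota>" for x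
      using that zero_outside[OF s] by (simp add: f_def)
    ultimately show ?thesis using memI_norm_le[of "\<lambda>x. f x - s n x" e] \<open>0 \<le> e\<close> by blast
  qed
  obtain K where "\<forall>m\<ge>K. \<forall>n\<ge>K. N (\<lambda>x. s m x - s n x) < 1" using cauchy[of 1] by auto
  then have "(\<lambda>x. f x - s K x) \<in> F" using close[of 1 K K] by simp
  then have "f \<in> F" using add_closed(1)[OF _ s[of K]] by fastforce
  moreover have "(\<lambda>n. N (\<lambda>x. s n x - f x)) \<longlonglongrightarrow> 0"
  proof (rule metric_LIMSEQ_I)
    fix e :: real assume "0 < e"
    then obtain K where K: "\<forall>m\<ge>K. \<forall>n\<ge>K. N (\<lambda>x. s m x - s n x) < e / 2"
      using cauchy[of "e / 2"] by auto
    have "N (\<lambda>x. s n x - f x) < e" if "K \<le> n" for n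
    proof -
      have "N (\<lambda>x. s n x - f x) = N (\<lambda>x. f x - s n x)"
        using scale_closed(2)[OF diff[OF s \<open>f \<in> F\<close>], of "- 1" n] by simp
      also have "\<dots> \<le> e / 2" using close[OF _ K that] \<open>0 < e\<close> by simp
      finally show ?thesis using \<open>0 < e\<close> by simp
    qed
    then show "\<exists>K. \<forall>n\<ge>K. dist (N (\<lambda>x. s n x - f x)) 0 < e" using N_nonneg[OF diff[OF s \<open>f \<in> F\<close>]] by auto
  qed
  ultimately show ?thesis by blast
qed

lemma eval_info: "(\<lambda>f. f (\<iota> i)) \<in> all_info F N"
  using value_le by (auto simp: all_info_def intro!: exI[of _ 1])

lemma hilbert: "hilbert_function_space (range \<iota>) F N"
proof
  show "f x = 0" if "f \<in> F" "x \<notin> range \<iota>" for f x using that by (rule zero_outside)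
  show "(\<lambda>x. 0) \<in> F" by (simp add: F_def)
  show "(\<lambda>x. f x + g x) \<in> F" "N (\<lambda>x. f x + g x) \<le> N f + N g" if "f \<in> F" "g \<in> F" for f g
    using add_closed[OF that] .
  show "(\<lambda>x. c * f x) \<in> F" "N (\<lambda>x. c * f x) = \<bar>c\<bar> * N f" if "f \<in> F" for c f
    using scale_closed[OF that] .
  show "0 \<le> N f" and "N f = 0 \<longleftrightarrow> f = (\<lambda>x. 0)" if "f \<in> F" for f
    using N_nonneg[OF that] norm_zero_iff[OF that] .
  show "\<exists>f\<in>F. (\<lambda>n. N (\<lambda>x. s n x - f x)) \<longlonglongrightarrow> 0"
    if "\<And>n. s n \<in> F" and "\<And>e. 0 < e \<Longrightarrow> \<exists>K::nat. \<forall>m\<ge>K. \<forall>n\<ge>K. N (\<lambda>x. s m x - s n x) < e"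
    for s using that by (rule norm_complete)
  show "std_info (range \<iota>) \<subseteq> all_info F N" using eval_info by (auto simp: std_info_def)
  have summ: "summable (\<lambda>i. (w i)\<^sup>2 * (f (\<iota> i) * g (\<iota> i)))" if "f \<in> F" "g \<in> F" for f g
  proof (rule summable_comparison_test')
    show "summable (\<lambda>i. (w i * f (\<iota> i))\<^sup>2 + (w i * g (\<iota> i))\<^sup>2)"
      using that by (intro summable_add) (auto simp: F_def)
    fix i
    show "norm ((w i)\<^sup>2 * (f (\<iota> i) * g (\<iota> i))) \<le> (w i * f (\<iota> i))\<^sup>2 + (w i * g (\<iota> i))\<^sup>2"
    proof -
      have "2 * (\<bar>w i * f (\<iota> i)\<bar> * \<bar>w i * g (\<iota> i)\<bar>) \<le> (w i * f (\<iota> i))\<^sup>2 + (w i * g (\<iota> i))\<^sup>2"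
        using sum_squares_bound[of "\<bar>w i * f (\<iota> i)\<bar>" "\<bar>w i * g (\<iota> i)\<bar>"] by (simp add: mult.assoc)
      moreover have "norm ((w i)\<^sup>2 * (f (\<iota> i) * g (\<iota> i))) = \<bar>w i * f (\<iota> i)\<bar> * \<bar>w i * g (\<iota> i)\<bar>"
        by (simp add: abs_mult power2_eq_square)
      ultimately show ?thesis using mult_nonneg_nonneg[of "\<bar>w i * f (\<iota> i)\<bar>" "\<bar>w i * g (\<iota> i)\<bar>"] by linarith
    qed
  qed
  define ip where "ip f g = (\<Sum>i. (w i)\<^sup>2 * (f (\<iota> i) * g (\<iota> i)))" for f g :: "'a \<Rightarrow> real"
  have "ip (\<lambda>x. f x + g x) h = ip f h + ip g h" if "f \<in> F" "g \<in> F" "h \<in> F" for f g h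
    unfolding ip_def using suminf_add[OF summ[of f h] summ[of g h]] that by (simp add: algebra_simps)
  moreover have "ip (\<lambda>x. c * f x) g = c * ip f g" if "f \<in> F" "g \<in> F" for c f g
    unfolding ip_def using suminf_mult[OF summ[OF that], of c] by (simp add: algebra_simps)
  moreover have "(N f)\<^sup>2 = ip f f" if "f \<in> F" for f
  proof -
    have "(\<Sum>i. (w i * f (\<iota> i))\<^sup>2) \<ge> 0" using that by (intro suminf_nonneg) (auto simp: F_def)
    then show ?thesis by (simp add: N_def ip_def power_mult_distrib power2_eq_square mult_ac)
  qed
  moreover have "ip f g = ip g f" for f g by (simp add: ip_def mult_ac)
  ultimately show "\<exists>ip. (\<forall>f\<in>F. \<forall>g\<in>F. ip f g = ip g f) \<and>
      (\<forall>f\<in>F. \<forall>g\<in>F. \<forall>h\<in>F. ip (\<lambda>x. f x + g x) h = ip f h + ip g h) \<and>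
      (\<forall>c. \<forall>f\<in>F. \<forall>g\<in>F. ip (\<lambda>x. c * f x) g = c * ip f g) \<and>
      (\<forall>f\<in>F. (N f)\<^sup>2 = ip f f)"
    by (intro exI[of _ ip]) blast
qed

abbreviation M :: "'a measure" where "M \<equiv> count_space (range \<iota>)"

lemma Linf_norm_le: "(\<And>i. \<bar>f (\<iota> i)\<bar> \<le> c) \<Longrightarrow> Lp_norm M \<infinity> f \<le> ennreal c"
  by (rule Linf_norm_leI) (auto simp: AE_count_space intro: ennreal_leI)

lemma Linf_norm_ge: "ennreal \<bar>f (\<iota> i)\<bar> \<le> Lp_norm M \<infinity> f"
  using Linf_norm_AE[of f M] by (auto simp: AE_count_space)

lemma embedded: "embedded_in_Lp M \<infinity> F N"
  unfolding embedded_in_Lp_def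
proof (intro conjI ballI impI)
  have le: "Lp_norm M \<infinity> f \<le> ennreal (1 * N f)" if "f \<in> F" for f
    using value_le[OF that] by (intro Linf_norm_le) simp
  show "F \<subseteq> Lp M \<infinity>"
  proof
    fix f assume "f \<in> F"
    have "Lp_norm M \<infinity> f < \<infinity>" by (rule le_less_trans[OF le[OF \<open>f \<in> F\<close>]]) simp
    then show "f \<in> Lp M \<infinity>" by (simp add: Lp_def)
  qed
  show "\<exists>C. \<forall>f\<in>F. Lp_norm M \<infinity> f \<le> ennreal (C * N f)" using le by blast
  show "f = g" if "f \<in> F" "g \<in> F" "AE x in M. f x = g x" for f g
  proof (rule ext)
    fix x
    show "f x = g x"
      using that zero_outside[of f x] zero_outside[of g x]
      by (cases "x \<in> range \<iota>") (auto simp: AE_count_space)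
  qed
qed

lemma unit_vector_mem: "(\<lambda>x. of_bool (x = \<iota> k)) \<in> F"
proof -
  have "(\<lambda>i. (w i * of_bool (\<iota> i = \<iota> k))\<^sup>2) = (\<lambda>i. if i = k then (w k)\<^sup>2 else 0)"
    by (auto simp: fun_eq_iff inj_eq[OF inj])
  then show ?thesis by (auto simp: F_def)
qed

lemma finite_combination_mem:
  shows "(\<lambda>x. \<Sum>k<m. b k * of_bool (x = \<iota> k)) \<in> F"
    and "linear_form F L \<Longrightarrow>
      L (\<lambda>x. \<Sum>k<m. b k * of_bool (x = \<iota> k)) = (\<Sum>k<m. b k * L (\<lambda>x. of_bool (x = \<iota> k)))"
proof (induction m)
  case 0
  {
    case 1
    show ?case by (simp add: F_def)
  next
    case 2
    then show ?case using linear_form_scale[of F L "\<lambda>x. 0" 0] by (simp add: F_def)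
  }
next
  case (Suc m)
  note unit = scale_closed(1)[OF unit_vector_mem[of m], of "b m"]
  {
    case 1
    show ?case using add_closed(1)[OF Suc(1) unit] by simp
  next
    case 2
    then show ?case
      using linear_form_add[OF 2 Suc(1) unit] linear_form_scale[OF 2 unit_vector_mem] Suc(2) by simp
  }
qed

lemma finite_combination_value:
  "(\<Sum>k<m. b k * of_bool (\<iota> i = \<iota> k)) = (if i < m then b i else (0::real))"
proof -
  have "(\<Sum>k<m. b k * of_bool (\<iota> i = \<iota> k)) = (\<Sum>k<m. if i = k then b k else 0)"
    by (intro sum.cong) (auto simp: inj_eq[OF inj])
  then show ?thesis by simp
qed

lemma min_error_le:
  assumes "mono w"
  shows "min_error M \<infinity> F N (all_info F N) n \<le> ennreal (1 / w n)"
proof -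
  define \<phi> where "\<phi> ys x = (\<Sum>k<n. (ys ! k) * of_bool (x = \<iota> k))" for ys :: "real list" and x
  define A where "A = (\<lambda>f. \<phi> (info (\<lambda>ys f. f (\<iota> (length ys))) f n))"
  have \<phi>: "\<phi> ys (\<iota> i) = (if i < n then ys ! i else 0)" for ys i
    unfolding \<phi>_def by (rule finite_combination_value)
  have "\<phi> ys \<in> Lp M \<infinity>" for ys
    using embedded finite_combination_mem(1)[of "\<lambda>k. ys ! k" n]
    by (auto simp: embedded_in_Lp_def \<phi>_def[abs_def])
  then have "A \<in> algorithms M \<infinity> (all_info F N) n"
    unfolding algorithms_def A_def using eval_info
    by (auto intro!: exI[of _ "\<lambda>ys f. f (\<iota> (length ys))"] exI[of _ \<phi>])
  then have "min_error M \<infinity> F N (all_info F N) n \<le> wor_error M \<infinity> F N A"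
    unfolding min_error_def by (rule INF_lower)
  also have "\<dots> \<le> ennreal (1 / w n)"
    unfolding wor_error_def
  proof (rule SUP_least, rule Linf_norm_le)
    fix f i assume "f \<in> {f \<in> F. N f \<le> 1}"
    then have f: "f \<in> F" "N f \<le> 1" by auto
    show "\<bar>f (\<iota> i) - A f (\<iota> i)\<bar> \<le> 1 / w n"
    proof (cases "i < n")
      case True
      then show ?thesis using w_ge_1[of n] by (simp add: A_def \<phi> info_eval)
    next
      case False
      then have "w n \<le> w i" using \<open>mono w\<close> by (simp add: mono_def)
      then have "w n * \<bar>f (\<iota> i)\<bar> \<le> w i * \<bar>f (\<iota> i)\<bar>" by (rule mult_right_mono) simp
      then have "w n * \<bar>f (\<iota> i)\<bar> \<le> 1" using weighted_value_le[OF f(1), of i] f(2) by linarith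
      then show ?thesis using False w_ge_1[of n] by (simp add: A_def \<phi> field_simps)
    qed
  qed
  finally show ?thesis .
qed

text \<open>The kernel of \<open>n\<close> functionals contains a unit vector supported on the first \<open>2 n\<close> points with a
weighted coordinate of at least \<open>sqrt (1 / 2)\<close>, and the weight there is at most \<open>w (2 n)\<close>.\<close>

lemma min_error_ge:
  assumes "mono w" and "1 \<le> n"
  shows "ennreal (1 / (sqrt 2 * w (2 * n))) \<le> min_error M \<infinity> F N (all_info F N) n"
  unfolding min_error_def
proof (rule INF_greatest)
  fix A assume A: "A \<in> algorithms M \<infinity> (all_info F N) n"
  show "ennreal (1 / (sqrt 2 * w (2 * n))) \<le> wor_error M \<infinity> F N A"
  proof (cases "wor_error M \<infinity> F N A")
    case (real E)
    have space: "banach_function_space (space M) F N"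
      using hilbert by (simp add: hilbert_function_space_def)
    obtain L where L: "\<And>i. i < n \<Longrightarrow> L i \<in> all_info F N"
      and ker: "\<And>f. f \<in> F \<Longrightarrow> (\<And>i. i < n \<Longrightarrow> L i f = 0) \<Longrightarrow> Lp_norm M \<infinity> f \<le> ennreal (E * N f)"
      by (rule Linf_norm_le_on_kernel[OF space embedded A eq_refl[OF real(2)] real(1)]) blast
    define l where "l j k = L j (\<lambda>x. of_bool (x = \<iota> k)) / w k" for j k
    have "n + n \<le> 2 * n" "0 < n" using \<open>1 \<le> n\<close> by auto
    then obtain a i where i: "i < 2 * n" and a1: "(\<Sum>i<2 * n. (a i)\<^sup>2) = 1"
      and la: "\<And>j. j < n \<Longrightarrow> (\<Sum>i<2 * n. l j i * a i) = 0"
      and ai: "real n / real (2 * n) \<le> (a i)\<^sup>2"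
      by (rule kernel_has_large_coordinate[of n n "2 * n" l]) blast
    define f where "f x = (\<Sum>k<2 * n. (a k / w k) * of_bool (x = \<iota> k))" for x
    have w_nz: "w k \<noteq> 0" for k using w_ge_1[of k] by simp
    have f: "f \<in> F" unfolding f_def[abs_def] by (rule finite_combination_mem(1))
    have f_val: "f (\<iota> k) = (if k < 2 * n then a k / w k else 0)" for k
      unfolding f_def by (rule finite_combination_value)
    have "L j f = 0" if "j < n" for j
    proof -
      have "linear_form F (L j)" using L[OF that] by (simp add: all_info_iff)
      then have "L j f = (\<Sum>k<2 * n. (a k / w k) * L j (\<lambda>x. of_bool (x = \<iota> k)))"
        unfolding f_def[abs_def] by (rule finite_combination_mem(2))
      also have "\<dots> = (\<Sum>k<2 * n. l j k * a k)" by (simp add: l_def mult_ac)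
      finally show ?thesis using la[OF that] by simp
    qed
    then have "Lp_norm M \<infinity> f \<le> ennreal (E * N f)" using ker f by blast
    then have "ennreal \<bar>f (\<iota> i)\<bar> \<le> ennreal (E * N f)"
      using Linf_norm_ge[of f i] by (rule order_trans[rotated])
    then have f_le: "\<bar>f (\<iota> i)\<bar> \<le> E * N f" using real(1) N_nonneg[OF f] by (simp add: ennreal_le_iff)
    have "N f \<le> 1"
    proof (rule memI_norm_le(2))
      show "L2_set (\<lambda>k. w k * f (\<iota> k)) {..<m} \<le> 1" for m
      proof -
        have "(\<Sum>k<m. (w k * f (\<iota> k))\<^sup>2) = (\<Sum>k<m. if k \<in> {..<2 * n} then (a k)\<^sup>2 else 0)"
          by (intro sum.cong) (auto simp: f_val w_nz)
        also have "\<dots> = (\<Sum>k\<in>{..<m} \<inter> {..<2 * n}. (a k)\<^sup>2)" by (rule sum.inter_restrict[symmetric]) simp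
        also have "\<dots> \<le> (\<Sum>k<2 * n. (a k)\<^sup>2)" by (intro sum_mono2) auto
        finally show ?thesis using a1 by (simp add: L2_set_def)
      qed
    qed (use zero_outside[OF f] in auto)
    then have "\<bar>f (\<iota> i)\<bar> \<le> E" using f_le mult_left_mono[of "N f" 1 E] real(1) by simp
    then have "\<bar>a i\<bar> / w i \<le> E" using i w_ge_1[of i] by (simp add: f_val abs_divide)
    moreover have "1 / (sqrt 2 * w (2 * n)) \<le> \<bar>a i\<bar> / w i"
    proof -
      have "1 / 2 \<le> (a i)\<^sup>2" using ai \<open>1 \<le> n\<close> by simp
      then have "sqrt (1 / 2) \<le> \<bar>a i\<bar>" using real_sqrt_le_mono[of "1 / 2" "(a i)\<^sup>2"] by simp
      then have "(1 / sqrt 2) * (1 / w (2 * n)) \<le> \<bar>a i\<bar> * (1 / w i)"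
        using i \<open>mono w\<close> w_ge_1[of i] w_ge_1[of "2 * n"]
        by (intro mult_mono divide_left_mono) (auto simp: mono_def real_sqrt_divide)
      then show ?thesis by simp
    qed
    ultimately have "ennreal (1 / (sqrt 2 * w (2 * n))) \<le> ennreal E" by (intro ennreal_leI) simp
    then show ?thesis by (simp only: real)
  qed simp
qed

end

section \<open>Power functions for uniform approximation\<close>

lemma ex_hilbert_function_space_with_rate:
  fixes r :: real
  assumes "infinite (UNIV :: 'a set)" and "0 < r"
  shows "\<exists>(M :: 'a measure) F N. hilbert_function_space (space M) F N \<and>
    embedded_in_Lp M \<infinity> F N \<and> rate_all M \<infinity> F N = ennreal r"
proof -
  obtain \<iota> :: "nat \<Rightarrow> 'a" where "inj \<iota>"
    using assms(1) infinite_iff_countable_subset[of "UNIV :: 'a set"] by auto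
  define w where "w i = real (Suc i) powr r" for i
  interpret weighted_l2 \<iota> w
    by unfold_locales (use \<open>inj \<iota>\<close> \<open>0 < r\<close> in \<open>auto simp: w_def intro: ge_one_powr_ge_zero\<close>)
  have "mono w" unfolding w_def using \<open>0 < r\<close> by (auto intro!: monoI powr_mono2)
  have "rate_all M \<infinity> F N = ennreal r"
    unfolding rate_all_def
  proof (rule rate_eqI[OF \<open>0 < r\<close>])
    show "0 < 1 / (sqrt 2 * 3 powr r)" by simp
    fix n :: nat assume "1 \<le> n"
    have "w (2 * n) \<le> (3 * real n) powr r"
      unfolding w_def using \<open>1 \<le> n\<close> \<open>0 < r\<close> by (intro powr_mono2) auto
    also have "\<dots> = 3 powr r * real n powr r" by (rule powr_mult)
    finally have "sqrt 2 * w (2 * n) \<le> sqrt 2 * (3 powr r * real n powr r)" by simp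
    then have "1 / (sqrt 2 * (3 powr r * real n powr r)) \<le> 1 / (sqrt 2 * w (2 * n))"
      using \<open>1 \<le> n\<close> w_ge_1[of "2 * n"] by (intro divide_left_mono) auto
    then have "1 / (sqrt 2 * 3 powr r) * real n powr - r \<le> 1 / (sqrt 2 * w (2 * n))"
      by (simp add: powr_minus_divide)
    then show "ennreal (1 / (sqrt 2 * 3 powr r) * real n powr - r) \<le> min_error M \<infinity> F N (all_info F N) n"
      by (rule order_trans[OF ennreal_leI min_error_ge[OF \<open>mono w\<close> \<open>1 \<le> n\<close>]])
    have "real n powr r \<le> w n" unfolding w_def using \<open>0 < r\<close> by (intro powr_mono2) auto
    then have "1 / w n \<le> 1 * real n powr - r"
      using \<open>1 \<le> n\<close> w_ge_1[of n] by (simp add: powr_minus_divide divide_left_mono)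
    then show "min_error M \<infinity> F N (all_info F N) n \<le> ennreal (1 * real n powr - r)"
      by (rule order_trans[OF min_error_le[OF \<open>mono w\<close>] ennreal_leI])
  qed
  moreover have "hilbert_function_space (space M) F N" using hilbert by simp
  ultimately show ?thesis using embedded by blast
qed

lemma hilbert_imp_banach: "hilbert_function_space \<Omega> F N \<Longrightarrow> banach_function_space \<Omega> F N"
  by (simp add: hilbert_function_space_def)

text \<open>A Hilbert space with a positive rate has a common null set, so it is among the Banach spaces over which
the other infimum is taken.\<close>

lemma power_fun_B_le_power_fun_H:
  assumes "0 < r"
  shows "power_fun_B TYPE('a) r \<infinity> \<le> power_fun_H TYPE('a) r \<infinity>"
  unfolding power_fun_B_def power_fun_H_def
proof (rule Inf_superset_mono, clarify)
  fix M :: "'a measure" and F N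
  assume H: "hilbert_function_space (space M) F N" and emb: "embedded_in_Lp M \<infinity> F N"
    and rate: "rate_all M \<infinity> F N = ennreal r"
  have "min_error M \<infinity> F N (all_info F N) \<longlonglongrightarrow> 0"
    using rate \<open>0 < r\<close> by (intro errors_tend_to_zero_if_rate_pos) (simp add: rate_all_def)
  then have "common_null_set M F" by (rule hilbert_common_null_set[OF H emb])
  then show "\<exists>(M' :: 'a measure) F' N'. rate_std M \<infinity> F N / ennreal r = rate_std M' \<infinity> F' N' / ennreal r \<and>
      banach_function_space (space M') F' N' \<and> embedded_in_Lp M' \<infinity> F' N' \<and>
      ((\<infinity> :: ennreal) = \<infinity> \<longrightarrow> common_null_set M' F') \<and> rate_all M' \<infinity> F' N' = ennreal r"
    using hilbert_imp_banach[OF H] emb rate by blast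
qed

lemma power_fun_B_ge:
  assumes "1 < r"
  shows "ennreal ((r - 1) / r) \<le> power_fun_B TYPE('a) r \<infinity>"
  unfolding power_fun_B_def
proof (rule Inf_greatest, clarify)
  fix M :: "'a measure" and F N
  assume space: "banach_function_space (space M) F N" and emb: "embedded_in_Lp M \<infinity> F N"
    and common: "(\<infinity> :: ennreal) = \<infinity> \<longrightarrow> common_null_set M F" and rate: "rate_all M \<infinity> F N = ennreal r"
  from common have "common_null_set M F" by simp
  then have "ennreal (r - 1) \<le> rate_std M \<infinity> F N"
    by (rule rate_std_ge[OF space emb _ rate \<open>1 < r\<close>])
  then have "ennreal (r - 1) / ennreal r \<le> rate_std M \<infinity> F N / ennreal r"
    by (rule divide_right_mono_ennreal)
  then show "ennreal ((r - 1) / r) \<le> rate_std M \<infinity> F N / ennreal r"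
    using \<open>1 < r\<close> by (simp add: divide_ennreal)
qed

lemma power_fun_H_le_1:
  assumes "infinite (UNIV :: 'a set)" and "0 < r"
  shows "power_fun_H TYPE('a) r \<infinity> \<le> 1"
proof -
  obtain M :: "'a measure" and F N where H: "hilbert_function_space (space M) F N"
    and emb: "embedded_in_Lp M \<infinity> F N" and rate: "rate_all M \<infinity> F N = ennreal r"
    using ex_hilbert_function_space_with_rate[OF assms] by blast
  have "power_fun_H TYPE('a) r \<infinity> \<le> rate_std M \<infinity> F N / ennreal r"
    unfolding power_fun_H_def using H emb rate by (intro Inf_lower) blast
  also have "\<dots> \<le> ennreal r / ennreal r"
    using rate_std_le_rate_all[OF hilbert_imp_banach[OF H], of \<infinity>]
    by (intro divide_right_mono_ennreal) (simp only: rate)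
  also have "\<dots> = 1" using \<open>0 < r\<close> by simp
  finally show ?thesis .
qed

theorem theorem4:
  fixes r :: real
  assumes "infinite (UNIV :: 'a set)" and "r > 1"
  shows "power_fun_H TYPE('a) r \<infinity> \<in> {ennreal ((r - 1) / r)..1} \<and>
         power_fun_B TYPE('a) r \<infinity> \<in> {ennreal ((r - 1) / r)..1}"
proof -
  have "power_fun_B TYPE('a) r \<infinity> \<le> power_fun_H TYPE('a) r \<infinity>"
    using assms(2) by (intro power_fun_B_le_power_fun_H) simp
  moreover have "power_fun_H TYPE('a) r \<infinity> \<le> 1"
    using assms by (intro power_fun_H_le_1) auto
  moreover have "ennreal ((r - 1) / r) \<le> power_fun_B TYPE('a) r \<infinity>"
    using assms(2) by (rule power_fun_B_ge)
  ultimately show ?thesis by auto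
qed

end
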